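(* Let $\kappa$ be a cardinal such that $\kappa>\mathfrak{c}$, and let $\tau=\log\kappa$. For a subset $S$ of an abelian group $G$, the following conditions are equivalent: (i) there exists an injective group homomorphism $\varpi:G\to \mathbb{T}^\kappa$ such that $\varpi(S)$ is dense in $\mathbb{T}^\kappa$; (ii) $|G|\le 2^\kappa$ and $\tau\le \min\{|nS|:n\in\mathbb{N}\}$; (iii) $|G|\le 2^\kappa$ and $S$ is $\tau$-wide.
   Context: $\mathbb{N}$ is the set of positive integers, $\mathfrak{c}$ is the cardinality of the continuum, and $\mathbb{T}=\mathbb{R}/\mathbb{Z}$ is the circle group with its usual topology; $\mathbb{T}^\kappa$ carries the product topology. For an infinite cardinal $\kappa$, $\log\kappa=\min\{\tau\ge\omega:\kappa\le 2^\tau\}$. For a subset $X$ of an abelian group, $nX=\{nx:x\in X\}$ and $\langle X\rangle$ is the subgroup generated by $X$. For an infinite cardinal $\tau$, a subset $S$ of an abelian group $G$ is $\tau$-wide if $nS\setminus\langle S'\rangle\neq\emptyset$ for every $n\in\mathbb{N}$ and each $S'\subseteq S$ with $|S'|<\tau$. *)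

theory Defs
  imports "HOL-Analysis.Analysis" "HOL-Algebra.Product_Groups"
begin

unbundle cardinal_syntax

section \<open>Cardinals\<close>

definition min_card :: "'a rel set \<Rightarrow> 'a rel"
  where "min_card R = (SOME r. r \<in> R \<and> (\<forall>r'\<in>R. r \<le>o r'))"

lemma min_card:
  assumes "R \<noteq> {}" and "\<And>r. r \<in> R \<Longrightarrow> Card_order r"
  shows "min_card R \<in> R" and "\<And>r. r \<in> R \<Longrightarrow> min_card R \<le>o r"
proof -
  have "\<exists>r. r \<in> R \<and> (\<forall>r'\<in>R. r \<le>o r')"
    using exists_minim_Card_order[of R] assms by blast
  then have "min_card R \<in> R \<and> (\<forall>r'\<in>R. min_card R \<le>o r')"
    unfolding min_card_def by (rule someI_ex)
  then show "min_card R \<in> R" and "\<And>r. r \<in> R \<Longrightarrow> min_card R \<le>o r" by auto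
qed

text \<open>As with \<^const>\<open>cardSuc\<close>, the minimum is taken over the cardinals of one fixed type; for
  infinite \<open>\<kappa>\<close> this loses nothing, see \<open>clog_least\<close> below.\<close>

definition clog :: "'k rel \<Rightarrow> 'k rel"
  where "clog \<kappa> = min_card {\<tau> :: 'k rel. Card_order \<tau> \<and> natLeq \<le>o \<tau> \<and> \<kappa> \<le>o ctwo ^c \<tau>}"

lemma clog:
  assumes "Card_order \<kappa>" and "natLeq \<le>o \<kappa>"
  shows "Card_order (clog \<kappa>)" and "natLeq \<le>o clog \<kappa>" and "\<kappa> \<le>o ctwo ^c clog \<kappa>"
    and "clog \<kappa> \<le>o \<kappa>"
proof -
  let ?R = "{\<tau> :: 'a rel. Card_order \<tau> \<and> natLeq \<le>o \<tau> \<and> \<kappa> \<le>o ctwo ^c \<tau>}"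
  have mem: "\<kappa> \<in> ?R"
    using assms ordLess_imp_ordLeq[OF ordLess_ctwo_cexp] by auto
  have *: "clog \<kappa> \<in> ?R"
    unfolding clog_def using mem by (intro min_card) auto
  then show "Card_order (clog \<kappa>)" "natLeq \<le>o clog \<kappa>" "\<kappa> \<le>o ctwo ^c clog \<kappa>" by auto
  show "clog \<kappa> \<le>o \<kappa>"
    unfolding clog_def using mem by (intro min_card) auto
qed

lemma clog_least:
  fixes \<kappa> :: "'k rel" and \<sigma> :: "'s rel"
  assumes "Card_order \<kappa>" "natLeq \<le>o \<kappa>" and "Card_order \<sigma>" "natLeq \<le>o \<sigma>" "\<kappa> \<le>o ctwo ^c \<sigma>"
  shows "clog \<kappa> \<le>o \<sigma>"
proof (cases "\<kappa> \<le>o \<sigma>")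
  case True
  then show ?thesis by (rule ordLeq_transitive[OF clog(4)[OF assms(1,2)]])
next
  case False
  then have "\<sigma> \<le>o \<kappa>"
    using ordLeq_total[of \<kappa> \<sigma>] card_order_on_well_order_on[OF assms(1)]
      card_order_on_well_order_on[OF assms(3)] by simp
  then have "|Field \<sigma>| \<le>o |Field \<kappa>|"
    by (rule card_of_mono2)
  then obtain g :: "'s \<Rightarrow> 'k" where g: "inj_on g (Field \<sigma>)"
    using card_of_ordLeq[of "Field \<sigma>" "Field \<kappa>"] by blast
  have "|Field \<sigma>| =o |g ` Field \<sigma>|"
    using inj_on_imp_bij_betw[OF g] card_of_ordIso by blast
  then have "|g ` Field \<sigma>| =o \<sigma>"
    using ordIso_transitive[OF ordIso_symmetric card_of_Field_ordIso[OF assms(3)]] by simp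
  then obtain \<sigma>' :: "'k rel" where s: "Card_order \<sigma>'" "\<sigma>' =o \<sigma>"
    using card_of_Card_order[of "g ` Field \<sigma>"] by blast
  have "natLeq \<le>o \<sigma>'"
    by (rule ordLeq_ordIso_trans[OF assms(4) ordIso_symmetric[OF s(2)]])
  moreover have "ctwo ^c \<sigma> =o ctwo ^c \<sigma>'"
    by (rule cexp_cong2[OF ordIso_symmetric[OF s(2)] Card_order_ctwo assms(3)])
  then have "\<kappa> \<le>o ctwo ^c \<sigma>'"
    by (rule ordLeq_ordIso_trans[OF assms(5)])
  ultimately have "clog \<kappa> \<le>o \<sigma>'"
    unfolding clog_def using s(1) by (intro min_card(2)) auto
  then show ?thesis using s(2) by (rule ordLeq_ordIso_trans)
qed

section \<open>The circle group and its powers\<close>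

definition real_group :: "real monoid"
  where "real_group = \<lparr>carrier = UNIV, monoid.mult = (+), one = 0\<rparr>"

definition circle_group :: "real set monoid"
  where "circle_group = real_group Mod \<int>"

definition circle_proj :: "real \<Rightarrow> real set"
  where "circle_proj x = \<int> #>\<^bsub>real_group\<^esub> x"

text \<open>The quotient topology of \<open>\<real>/\<int>\<close>.\<close>

definition circle_topology :: "real set topology"
  where "circle_topology =
    topology (\<lambda>U. U \<subseteq> carrier circle_group \<and> open {x. circle_proj x \<in> U})"

text \<open>A cardinal is a relation here, and the index set of the power \<open>T\<^sup>\<kappa>\<close> is its field.\<close>

definition torus_group :: "'k rel \<Rightarrow> ('k \<Rightarrow> real set) monoid"
  where "torus_group \<kappa> = product_group (Field \<kappa>) (\<lambda>_. circle_group)"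

definition torus_topology :: "'k rel \<Rightarrow> ('k \<Rightarrow> real set) topology"
  where "torus_topology \<kappa> = product_topology (\<lambda>_. circle_topology) (Field \<kappa>)"

lemma comm_group_real_group: "comm_group real_group"
proof (rule comm_groupI)
  fix x
  show "\<exists>y\<in>carrier real_group. y \<otimes>\<^bsub>real_group\<^esub> x = \<one>\<^bsub>real_group\<^esub>"
    by (rule bexI[of _ "- x"]) (simp_all add: real_group_def)
qed (simp_all add: real_group_def)

lemma normal_Ints: "\<int> \<lhd> real_group"
proof -
  interpret comm_group real_group by (rule comm_group_real_group)
  have inv: "inv\<^bsub>real_group\<^esub> x = - x" for x
    by (rule inv_equality) (auto simp: real_group_def)
  have "subgroup \<int> real_group"
    by (rule subgroupI) (auto simp: inv, auto simp: real_group_def)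
  then show ?thesis by (rule subgroup_imp_normal)
qed

lemma comm_group_circle_group: "comm_group circle_group"
  unfolding circle_group_def
  using comm_group.abelian_FactGroup[OF comm_group_real_group]
    normal_imp_subgroup[OF normal_Ints] by blast

lemma carrier_circle_group: "carrier circle_group = range circle_proj"
  by (simp add: circle_group_def carrier_FactGroup circle_proj_def[abs_def] real_group_def)

lemma openin_circle_topology:
  "openin circle_topology U \<longleftrightarrow> U \<subseteq> carrier circle_group \<and> open {x. circle_proj x \<in> U}"
proof -
  have "istopology (\<lambda>U. U \<subseteq> carrier circle_group \<and> open {x. circle_proj x \<in> U})"
    unfolding istopology_def
  proof (intro conjI allI impI)
    fix \<K> :: "real set set set"
    assume *: "\<forall>K\<in>\<K>. K \<subseteq> carrier circle_group \<and> open {x. circle_proj x \<in> K}"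
    then show "\<Union>\<K> \<subseteq> carrier circle_group" by blast
    have "{x. circle_proj x \<in> \<Union>\<K>} = (\<Union>K\<in>\<K>. {x. circle_proj x \<in> K})" by blast
    then show "open {x. circle_proj x \<in> \<Union>\<K>}" using * by auto
  next
    fix S T
    assume "S \<subseteq> carrier circle_group \<and> open {x. circle_proj x \<in> S}"
      and "T \<subseteq> carrier circle_group \<and> open {x. circle_proj x \<in> T}"
    then show "open {x. circle_proj x \<in> S \<inter> T}"
      using open_Int[of "{x. circle_proj x \<in> S}" "{x. circle_proj x \<in> T}"]
      by (simp add: Collect_conj_eq)
  qed blast
  then show ?thesis unfolding circle_topology_def by (simp add: topology_inverse')
qed

lemma topspace_circle_topology: "topspace circle_topology = carrier circle_group"
proof
  show "topspace circle_topology \<subseteq> carrier circle_group"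
    using openin_topspace[of circle_topology] openin_circle_topology by blast
  have "openin circle_topology (carrier circle_group)"
    by (simp add: openin_circle_topology carrier_circle_group)
  then show "carrier circle_group \<subseteq> topspace circle_topology"
    by (rule openin_subset)
qed

lemma quotient_map_circle_proj: "quotient_map euclidean circle_topology circle_proj"
  unfolding quotient_map_def topspace_circle_topology
  by (auto simp: openin_circle_topology carrier_circle_group)

lemma topspace_torus_topology: "topspace (torus_topology \<kappa>) = carrier (torus_group \<kappa>)"
  by (simp add: torus_topology_def torus_group_def topspace_circle_topology)

section \<open>Multiples of a set and wide sets\<close>

text \<open>Abelian groups are those of \<open>HOL-Algebra\<close>, hence written multiplicatively: \<open>nx\<close> is
  \<open>x [^] n\<close>, and the subgroup generated by \<open>X\<close> is \<open>generate G X\<close>.\<close>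

definition multiples :: "('g, 'm) monoid_scheme \<Rightarrow> nat \<Rightarrow> 'g set \<Rightarrow> 'g set"
  where "multiples G n X = (\<lambda>x. x [^]\<^bsub>G\<^esub> n) ` X"

definition wide :: "('g, 'm) monoid_scheme \<Rightarrow> 't rel \<Rightarrow> 'g set \<Rightarrow> bool"
  where "wide G \<tau> S \<longleftrightarrow>
    (\<forall>n>0. \<forall>S'\<subseteq>S. |S'| <o \<tau> \<longrightarrow> multiples G n S - generate G S' \<noteq> {})"

end

theory Submission
  imports Defs
begin

text \<open>
  If \<open>\<phi>(S)\<close> is dense, so is \<open>n\<phi>(S)\<close>; its elements separate the coordinates of \<open>T\<^sup>\<kappa>\<close>, so
  \<open>\<kappa> \<le> 2\<^bsup>|nS|\<^esup>\<close>. Wideness is equivalent to the bound on \<open>|nS|\<close> because \<open>\<tau>\<close> is uncountable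
  (as \<open>\<kappa> > 2\<^sup>\<omega>\<close>), so that fewer than \<open>\<tau>\<close> elements generate a subgroup of size less than \<open>\<tau>\<close>.

  For the construction of \<open>\<phi>\<close>, let a monomorphism into \<open>T\<^sup>\<kappa>\<close> be defined on a subgroup \<open>H\<close> with
  \<open>|H| < 2\<^sup>\<kappa>\<close>, and let \<open>x\<close> have order \<open>m > N\<close> modulo \<open>H\<close>. The value prescribed at \<open>mx\<close> leaves
  for \<open>x\<close> in each coordinate at least two values within \<open>2/m\<close> of a given target, hence \<open>2\<^sup>\<kappa>\<close>
  values altogether, and all but \<open>\<omega> |H|\<close> of them give an extension that is again injective. By
  Hewitt--Marczewski--Pondiczery there are \<open>\<tau>\<close> targets that are dense in \<open>T\<^sup>\<kappa>\<close>. A transfinite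
  recursion of length \<open>\<tau>\<close> picks for each target and each \<open>N\<close> an element \<open>x\<close> of \<open>S\<close> of order \<open>> N\<close>
  modulo the previous ones, and sends it close to the target; for this, \<open>N! x\<close> only has to avoid a
  subgroup of size less than \<open>\<tau> \<le> |N! S|\<close>. A second recursion extends the result to \<open>G\<close>.
\<close>

section \<open>Cardinal estimates\<close>

text \<open>Lists of one fixed length are counted by induction, using that an infinite cardinal
  absorbs products; there are only countably many lengths.\<close>

lemma card_of_lists_le:
  assumes "infinite Z" "|A| \<le>o |Z|"
  shows "|lists A| \<le>o |Z|"
proof -
  let ?L = "\<lambda>n::nat. {xs \<in> lists A. length xs = n}"
  have "|?L n| \<le>o |Z|" for n
  proof (induction n)
    case 0
    have "?L 0 = {[]}" by auto
    then show ?case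
      using assms(1) card_of_singl_ordLeq[of Z] by fastforce
  next
    case (Suc n)
    have "?L (Suc n) \<subseteq> (\<lambda>(x, xs). x # xs) ` (A \<times> ?L n)"
      by (auto simp: length_Suc_conv)
    then have "|?L (Suc n)| \<le>o |A \<times> ?L n|" by (rule surj_imp_ordLeq)
    also have "|A \<times> ?L n| \<le>o |Z|"
      using card_of_Times_ordLeq_infinite_Field[of "|Z|" A "?L n"] assms Suc
      by (simp add: card_of_card_order_on Field_card_of)
    finally show ?case .
  qed
  then have "|\<Union>n\<in>UNIV. ?L n| \<le>o |Z|"
    using assms(1) by (intro card_of_UNION_ordLeq_infinite) (auto simp: infinite_iff_card_of_nat)
  moreover have "(\<Union>n\<in>UNIV. ?L n) = lists A" by auto
  ultimately show ?thesis by simp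
qed

lemma card_of_Times_le:
  assumes "infinite Z" "|A| \<le>o |Z|" "|B| \<le>o |Z|"
  shows "|A \<times> B| \<le>o |Z|"
  using card_of_Times_ordLeq_infinite_Field[of "|Z|" A B] assms by (simp add: card_of_card_order_on Field_card_of)

lemma card_of_Un_le:
  assumes "infinite Z" "|A| \<le>o |Z|" "|B| \<le>o |Z|"
  shows "|A \<union> B| \<le>o |Z|"
  using card_of_Un_ordLeq_infinite_Field[of "|Z|" A B] assms by (simp add: card_of_card_order_on Field_card_of)

lemma card_of_image_le: "|A| \<le>o r \<Longrightarrow> |f ` A| \<le>o r"
  by (rule ordLeq_transitive[OF card_of_image])

lemma card_of_countable_le: "infinite Z \<Longrightarrow> |A :: 'a::countable set| \<le>o |Z|"
  using card_of_ordLeqI[of to_nat A "UNIV :: nat set"] infinite_iff_card_of_nat[of Z] ordLeq_transitive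
  by (metis UNIV_I inj_on_subset inj_to_nat subset_UNIV)

text \<open>Every element of the generated subgroup is the product of a finite word in the elements
  of \<open>X\<close> and their inverses, so counting words suffices.\<close>

lemma card_of_generate_le:
  fixes G :: "('g, 'm) monoid_scheme"
  assumes "group G" "X \<subseteq> carrier G" "infinite Z" "|X| \<le>o |Z|"
  shows "|generate G X| \<le>o |Z|"
proof -
  interpret group G by fact
  let ?Y = "X \<union> m_inv G ` X" and ?p = "\<lambda>xs. foldr (\<lambda>x y. x \<otimes>\<^bsub>G\<^esub> y) xs \<one>\<^bsub>G\<^esub>"
  have Y: "?Y \<subseteq> carrier G" using assms(2) by auto
  have cl: "?p xs \<in> carrier G" if "set xs \<subseteq> carrier G" for xs
    using that by (induction xs) auto
  have app: "?p (xs @ ys) = ?p xs \<otimes>\<^bsub>G\<^esub> ?p ys" if "set xs \<subseteq> carrier G" "set ys \<subseteq> carrier G" for xs ys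
    using that cl by (induction xs) (auto simp: m_assoc)
  have "generate G X \<subseteq> ?p ` lists ?Y"
  proof
    fix z assume "z \<in> generate G X"
    then show "z \<in> ?p ` lists ?Y"
    proof induction
      case one
      show ?case by (rule image_eqI[of _ _ "[]"]) auto
    next
      case (incl h)
      then show ?case using assms(2) by (intro image_eqI[of _ _ "[h]"]) auto
    next
      case (inv h)
      then show ?case using assms(2) by (intro image_eqI[of _ _ "[inv\<^bsub>G\<^esub> h]"]) auto
    next
      case (eng h1 h2)
      then obtain xs ys where "h1 = ?p xs" "h2 = ?p ys" "xs \<in> lists ?Y" "ys \<in> lists ?Y" by auto
      then have "h1 \<otimes>\<^bsub>G\<^esub> h2 = ?p (xs @ ys)" "xs @ ys \<in> lists ?Y"
        using Y by (auto simp: in_lists_conv_set subset_iff simp del: foldr_append intro!: app[symmetric])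
      then show ?case by (rule image_eqI)
    qed
  qed
  then have "|generate G X| \<le>o |lists ?Y|" by (rule surj_imp_ordLeq)
  also have "|lists ?Y| \<le>o |Z|"
    using assms by (intro card_of_lists_le card_of_Un_le card_of_image_le)
  finally show ?thesis .
qed

text \<open>The bounds above need an infinite bounding set, while \<open>X\<close> may be finite.
  Adjoining the natural numbers gives an infinite set that is still smaller than \<open>Z\<close>,
  which turns those bounds into strict ones.\<close>

lemma card_of_less_infinite_cases:
  fixes X :: "'a set"
  assumes "|X| <o |Z|" "|UNIV::nat set| <o |Z|"
  obtains Y :: "('a + nat) set" where "infinite Y" "|X| \<le>o |Y|" "|Y| <o |Z|"
proof -
  have "infinite Z" using ordLess_imp_ordLeq[OF assms(2)] infinite_iff_card_of_nat by blast
  then have "|X <+> (UNIV :: nat set)| <o |Z|"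
    by (rule card_of_Plus_ordLess_infinite[OF _ assms])
  then show thesis by (intro that[of "X <+> UNIV"] card_of_Plus1) simp_all
qed

lemma card_of_generate_less:
  fixes G :: "('a, 'm) monoid_scheme"
  assumes "group G" "X \<subseteq> carrier G" "|X| <o |Z|" "|UNIV::nat set| <o |Z|"
  shows "|generate G X| <o |Z|"
proof -
  obtain Y :: "('a + nat) set" where "infinite Y" "|X| \<le>o |Y|" "|Y| <o |Z|"
    using card_of_less_infinite_cases[OF assms(3,4)] .
  then show ?thesis using card_of_generate_le[OF assms(1,2)] ordLeq_ordLess_trans by blast
qed

lemma card_of_nat_Times_less:
  fixes X :: "'a set"
  assumes "|X| <o |Z|" "|UNIV::nat set| <o |Z|"
  shows "|(UNIV::nat set) \<times> X| <o |Z|"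
proof -
  obtain Y :: "('a + nat) set" where Y: "infinite Y" "|X| \<le>o |Y|" "|Y| <o |Z|"
    using card_of_less_infinite_cases[OF assms] .
  have "|(UNIV::nat set) \<times> X| \<le>o |Y|"
    using Y by (intro card_of_Times_le) (auto simp: infinite_iff_card_of_nat)
  then show ?thesis using Y(3) by (rule ordLeq_ordLess_trans)
qed

lemma card_of_Pow_mono:
  assumes "|A| \<le>o |B|"
  shows "|Pow A| \<le>o |Pow B|"
proof -
  obtain f where f: "inj_on f A" "f ` A \<subseteq> B" using assms card_of_ordLeq by metis
  show ?thesis
    using f by (intro card_of_ordLeqI[of "image f"] inj_on_image_Pow) auto
qed

lemma card_of_Pow_Field_cexp: "|Pow (Field r)| =o ctwo ^c r"
  unfolding cexp_def ctwo_def Field_card_of by (rule card_of_Pow_Func)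

text \<open>If \<tau> were countable, its power set would have at most the size of the continuum,
  hence be smaller than \<kappa>.\<close>

lemma nat_less_of_real_less_cexp:
  assumes "Card_order \<tau>" "|UNIV :: real set| <o \<kappa>" "\<kappa> \<le>o ctwo ^c \<tau>"
  shows "|UNIV :: nat set| <o |Field \<tau>|"
proof (rule ccontr)
  assume "\<not> |UNIV :: nat set| <o |Field \<tau>|"
  then have "|Field \<tau>| \<le>o |UNIV :: nat set|" by (simp add: not_ordLess_iff_ordLeq card_of_Well_order)
  then have "|Pow (Field \<tau>)| \<le>o |Pow (UNIV :: nat set)|" by (rule card_of_Pow_mono)
  also have "|Pow (UNIV :: nat set)| \<le>o |UNIV :: real set|"
  proof -
    obtain f :: "nat set \<Rightarrow> real" where "bij f"
      using nat_sets_eqpoll_reals unfolding eqpoll_def by blast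
    then show ?thesis by (intro card_of_ordLeqI[of f]) (auto simp: bij_def inj_on_def)
  qed
  finally have "ctwo ^c \<tau> \<le>o |UNIV :: real set|"
    by (rule ordIso_ordLeq_trans[OF ordIso_symmetric[OF card_of_Pow_Field_cexp]])
  then have "\<kappa> \<le>o |UNIV :: real set|" using assms(3) ordLeq_transitive by blast
  then show False using assms(2) not_ordLess_ordLeq by blast
qed

lemma le_min_card_iff:
  fixes \<tau> :: "'t rel"
  assumes "R \<noteq> {}" "\<And>r. r \<in> R \<Longrightarrow> Card_order r"
  shows "\<tau> \<le>o min_card R \<longleftrightarrow> (\<forall>r\<in>R. \<tau> \<le>o r)"
  using min_card[OF assms] ordLeq_transitive by blast

section \<open>Partial monomorphisms into a power of the circle\<close>

text \<open>Points of the torus are handled through real representatives, so that roots and small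
  shifts are computed in the reals. The carrier contains all functions; the conditions imposed later
  look only at coordinates in \<open>K\<close>.\<close>

definition real_functions :: "('k \<Rightarrow> real) monoid"
  where "real_functions = \<lparr>carrier = UNIV, monoid.mult = (\<lambda>u v i. u i + v i), one = (\<lambda>_. 0)\<rparr>"

lemma real_functions_simps [simp]:
  "carrier real_functions = UNIV"
  "u \<otimes>\<^bsub>real_functions\<^esub> v = (\<lambda>i. u i + v i)"
  "\<one>\<^bsub>real_functions\<^esub> = (\<lambda>_. 0)"
  by (simp_all add: real_functions_def)

lemma comm_group_real_functions: "comm_group real_functions"
proof (rule comm_groupI)
  fix u :: "'a \<Rightarrow> real"
  show "\<exists>v\<in>carrier real_functions. v \<otimes>\<^bsub>real_functions\<^esub> u = \<one>\<^bsub>real_functions\<^esub>"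
    by (rule bexI[of _ "\<lambda>i. - u i"]) simp_all
qed (simp_all add: fun_eq_iff)

lemma inv_real_functions [simp]: "inv\<^bsub>real_functions\<^esub> u = (\<lambda>i. - u i)"
  using comm_group.axioms(2)[OF comm_group_real_functions]
  by (intro group.inv_equality) simp_all

lemma comm_group_DirProd:
  assumes "comm_group G" "comm_group H"
  shows "comm_group (G \<times>\<times> H)"
proof (rule group.group_comm_groupI)
  show "group (G \<times>\<times> H)"
    using assms by (intro DirProd_group comm_group.axioms(2))
  fix x y assume "x \<in> carrier (G \<times>\<times> H)" "y \<in> carrier (G \<times>\<times> H)"
  then show "x \<otimes>\<^bsub>G \<times>\<times> H\<^esub> y = y \<otimes>\<^bsub>G \<times>\<times> H\<^esub> x"
    using assms by (simp add: mult_DirProd' comm_group_def comm_monoid.m_comm mem_Times_iff)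
qed

lemma nat_pow_DirProd_real_functions:
  "(a, u) [^]\<^bsub>G \<times>\<times> real_functions\<^esub> (n::nat) = (a [^]\<^bsub>G\<^esub> n, \<lambda>i. real n * u i)"
  by (induction n) (simp_all add: fun_eq_iff distrib_right)

lemma int_pow_DirProd_real_functions:
  fixes u :: "'b \<Rightarrow> real"
  assumes "group G" "a \<in> carrier G"
  shows "(a, u) [^]\<^bsub>G \<times>\<times> real_functions\<^esub> (k::int) = (a [^]\<^bsub>G\<^esub> k, \<lambda>i. of_int k * u i)"
proof -
  have RF: "group (real_functions :: ('b \<Rightarrow> real) monoid)"
    using comm_group_real_functions by (rule comm_group.axioms(2))
  have GR: "group (G \<times>\<times> (real_functions :: ('b \<Rightarrow> real) monoid))"
    using assms(1) RF by (rule DirProd_group)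
  show ?thesis
  proof (cases k rule: int_cases2)
    case (nonneg n)
    then show ?thesis by (simp add: int_pow_int nat_pow_DirProd_real_functions)
  next
    case (nonpos n)
    have "a [^]\<^bsub>G\<^esub> n \<in> carrier G"
      using assms by (intro monoid.nat_pow_closed group.is_monoid)
    then show ?thesis
      using assms nonpos group.int_pow_neg_int[OF GR, of "(a, u)" n] group.int_pow_neg_int[OF assms, of n]
        inv_DirProd[OF assms(1) RF, of "a [^]\<^bsub>G\<^esub> n" "\<lambda>i. real n * u i"]
      by (simp add: nat_pow_DirProd_real_functions)
  qed
qed

text \<open>The recursion bounds the size of the domain of a partial monomorphism, not of the set of
  representatives, so generation in the product has to be compared with generation in
  \<open>G\<close>.\<close>

lemma fst_generate_DirProd:
  assumes "group G" "group H" "X \<subseteq> carrier (G \<times>\<times> H)"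
  shows "fst ` generate (G \<times>\<times> H) X \<subseteq> generate G (fst ` X)"
proof -
  have "fst z \<in> generate G (fst ` X)" if "z \<in> generate (G \<times>\<times> H) X" for z
    using that
  proof induction
    case (inv h)
    then have h: "fst h \<in> carrier G" "snd h \<in> carrier H" using assms(3) by auto
    have "fst (inv\<^bsub>G \<times>\<times> H\<^esub> h) = inv\<^bsub>G\<^esub> fst h"
      using inv_DirProd[OF assms(1,2) h] by simp
    then show ?case using inv by (auto intro: generate.inv)
  qed (auto simp: mult_DirProd' intro: generate.intros)
  then show ?thesis by auto
qed

text \<open>The graph of an isomorphism between a subgroup of \<open>G\<close> and a subgroup of \<open>T\<^sup>K\<close>, with
  the values in \<open>T\<^sup>K\<close> given by arbitrary representatives in \<open>\<real>\<^sup>K\<close>.\<close>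

definition partial_mon :: "('g, 'm) monoid_scheme \<Rightarrow> 'k set \<Rightarrow> ('g \<times> ('k \<Rightarrow> real)) set \<Rightarrow> bool"
  where "partial_mon G K P \<longleftrightarrow> subgroup P (G \<times>\<times> real_functions) \<and>
    (\<forall>(a, u)\<in>P. a = \<one>\<^bsub>G\<^esub> \<longleftrightarrow> (\<forall>i\<in>K. u i \<in> \<int>))"

context
  fixes G :: "('g, 'm) monoid_scheme" and K :: "'k set"
  assumes comm: "comm_group G"
begin

interpretation comm_group G by (rule comm)

interpretation RF: comm_group "real_functions :: ('k \<Rightarrow> real) monoid"
  by (rule comm_group_real_functions)

interpretation GR: comm_group "G \<times>\<times> (real_functions :: ('k \<Rightarrow> real) monoid)"
  by (rule comm_group_DirProd[OF comm comm_group_real_functions])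

section \<open>Algebra of partial monomorphisms and extension by one element\<close>

lemma partial_mon_mult:
  "partial_mon G K P \<Longrightarrow> (a, u) \<in> P \<Longrightarrow> (b, v) \<in> P \<Longrightarrow> (a \<otimes>\<^bsub>G\<^esub> b, \<lambda>i. u i + v i) \<in> P"
  unfolding partial_mon_def using subgroup.m_closed[of P "G \<times>\<times> real_functions" "(a, u)" "(b, v)"] by auto

lemma partial_mon_inv:
  assumes "partial_mon G K P" "(a, u) \<in> P"
  shows "(inv\<^bsub>G\<^esub> a, \<lambda>i. - u i) \<in> P"
proof -
  have "a \<in> carrier G"
    using assms unfolding partial_mon_def by (auto dest: subgroup.mem_carrier)
  then show ?thesis
    using assms subgroup.m_inv_closed[of P "G \<times>\<times> real_functions" "(a, u)"] inv_DirProd[OF is_group RF.is_group, of a u]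
    unfolding partial_mon_def by auto
qed

lemma partial_mon_carrier: "partial_mon G K P \<Longrightarrow> (a, u) \<in> P \<Longrightarrow> a \<in> carrier G"
  unfolding partial_mon_def by (auto dest: subgroup.mem_carrier)

lemma partial_mon_iff:
  "partial_mon G K P \<Longrightarrow> (a, u) \<in> P \<Longrightarrow> a = \<one>\<^bsub>G\<^esub> \<longleftrightarrow> (\<forall>i\<in>K. u i \<in> \<int>)"
  unfolding partial_mon_def by blast

lemma partial_mon_int_pow:
  assumes "partial_mon G K P" "(a, u) \<in> P"
  shows "(a [^]\<^bsub>G\<^esub> (k::int), \<lambda>i. of_int k * u i) \<in> P"
  using GR.subgroup_int_pow_closed[of P "(a, u)" k] assms partial_mon_carrier[OF assms]
  by (simp add: partial_mon_def int_pow_DirProd_real_functions is_group)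

text \<open>The defining condition, applied to the quotient of the two pairs, yields both
  directions: one is well-definedness modulo the integers on \<open>K\<close>, the other is
  injectivity.\<close>

lemma partial_mon_cong:
  assumes P: "partial_mon G K P" and "(a, u) \<in> P" "(b, v) \<in> P"
  shows "a = b \<longleftrightarrow> (\<forall>i\<in>K. u i - v i \<in> \<int>)"
proof -
  have "(a \<otimes>\<^bsub>G\<^esub> inv\<^bsub>G\<^esub> b, \<lambda>i. u i - v i) \<in> P"
    using partial_mon_mult[OF P assms(2) partial_mon_inv[OF P assms(3)]] by simp
  moreover have "a \<otimes>\<^bsub>G\<^esub> inv\<^bsub>G\<^esub> b = \<one>\<^bsub>G\<^esub> \<longleftrightarrow> a = b"
    using partial_mon_carrier[OF P] assms inv_solve_right[of "\<one>\<^bsub>G\<^esub>" a b] by auto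
  ultimately show ?thesis using partial_mon_iff[OF P] by auto
qed

text \<open>For fixed \<open>k\<close> and \<open>a\<close> at most one \<open>A\<close> is bad: two of them differ at some \<open>i\<close>, and there
  the difference of the two conditions is \<open>k * \<delta> \<in> \<int>\<close>.\<close>

lemma ex_generic_shift:
  fixes \<delta> :: real and R :: "nat set" and y :: "'k \<Rightarrow> real"
  assumes P: "partial_mon G K P" and small: "|fst ` P| <o |Pow K|" and inf: "infinite K"
    and \<delta>: "\<forall>k\<in>R. real k * \<delta> \<notin> \<int>"
  shows "\<exists>A. \<forall>k\<in>R. \<forall>(a, u)\<in>P.
    \<not> (\<forall>i\<in>K. u i + real k * (y i + (if i \<in> A then \<delta> else 0)) \<in> \<int>)"
proof -
  define y' where "y' A i = y i + (if i \<in> A then \<delta> else 0)" for A i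
  \<comment> \<open>The index is \<open>a\<close> alone and not the pair \<open>(a, u)\<close>: only
    the domain of \<open>P\<close> has a size bound, and two representatives of \<open>a\<close>
    differ by integers on \<open>K\<close>.\<close>
  define bad where "bad A k a \<longleftrightarrow> k \<in> R \<and> (\<exists>u. (a, u) \<in> P \<and> (\<forall>i\<in>K. u i + real k * y' A i \<in> \<int>))"
    for A k a
  let ?B = "{A \<in> Pow K. \<exists>k a. bad A k a}"
  have uniq: "A = B" if asm: "bad A k a" "bad B k a" "A \<subseteq> K" "B \<subseteq> K" for A B k a
  proof (rule ccontr)
    assume "A \<noteq> B"
    then obtain i where i: "i \<in> K" "i \<in> A \<longleftrightarrow> i \<notin> B" using asm(3,4) by blast
    obtain u v where uv: "(a, u) \<in> P" "(a, v) \<in> P" "u i + real k * y' A i \<in> \<int>"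
        "v i + real k * y' B i \<in> \<int>"
      using asm(1,2) i(1) unfolding bad_def by blast
    have "u i - v i \<in> \<int>" using partial_mon_cong[OF P uv(1,2)] i(1) by blast
    then have "(u i + real k * y' A i) - (v i + real k * y' B i) - (u i - v i) \<in> \<int>"
      using uv(3,4) by (intro Ints_diff[OF Ints_diff])
    also have "(u i + real k * y' A i) - (v i + real k * y' B i) - (u i - v i)
        = (if i \<in> A then real k * \<delta> else - (real k * \<delta>))"
      using i(2) by (auto simp: y'_def algebra_simps)
    finally have "real k * \<delta> \<in> \<int>" by (auto split: if_splits)
    then show False using \<delta> asm(1) unfolding bad_def by blast
  qed
  \<comment> \<open>Each bad set selects a pair \<open>(k, a)\<close> for which it is bad. By
    \<open>uniq\<close> this selection is injective, so there are fewer bad sets than subsets of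
    \<open>K\<close>.\<close>
  define h where "h A = (SOME p. bad A (fst p) (snd p))" for A
  have h: "bad A (fst (h A)) (snd (h A))" if "A \<in> ?B" for A
    unfolding h_def using that by (intro someI_ex[of "\<lambda>p. bad A (fst p) (snd p)"]) auto
  have "inj_on h ?B"
  proof (rule inj_onI)
    fix A B assume AB: "A \<in> ?B" "B \<in> ?B" "h A = h B"
    have sub: "A \<subseteq> K" "B \<subseteq> K" using AB(1,2) by (simp_all only: mem_Collect_eq Pow_iff)
    have "bad B (fst (h A)) (snd (h A))" using h[OF AB(2)] by (simp only: AB(3))
    then show "A = B" by (rule uniq[OF h[OF AB(1)] _ sub])
  qed
  moreover have "h ` ?B \<subseteq> UNIV \<times> fst ` P"
  proof (rule image_subsetI)
    fix A assume "A \<in> ?B"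
    then have "bad A (fst (h A)) (snd (h A))" by (rule h)
    then show "h A \<in> UNIV \<times> fst ` P"
      unfolding bad_def by (metis UNIV_I fst_conv image_eqI mem_Times_iff)
  qed
  ultimately have "|?B| \<le>o |(UNIV::nat set) \<times> fst ` P|"
    by (intro card_of_ordLeq[THEN iffD1, OF exI, OF conjI])
  also have "|(UNIV::nat set) \<times> fst ` P| <o |Pow K|"
  proof (rule card_of_nat_Times_less[OF small])
    show "|UNIV::nat set| <o |Pow K|"
      by (rule ordLeq_ordLess_trans[OF inf[unfolded infinite_iff_card_of_nat] card_of_Pow])
  qed
  finally have "?B \<noteq> Pow K" using ordLess_irreflexive[of "|Pow K|"] by (intro notI) (simp only:)
  then obtain A where A: "\<And>k a. \<not> bad A k a" by blast
  show ?thesis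
  proof (intro exI ballI, clarify)
    fix k a u
    assume "k \<in> R" "(a, u) \<in> P" "\<forall>i\<in>K. u i + real k * (y i + (if i \<in> A then \<delta> else 0)) \<in> \<int>"
    then have "bad A k a" unfolding bad_def y'_def by blast
    with A show False by blast
  qed
qed

text \<open>Here \<open>m\<close> is the order of \<open>x\<close> modulo the domain of \<open>P\<close>, with \<open>m = 0\<close> for infinite order, and
  \<open>R\<close> is the set of all \<open>k\<close> for which \<open>k * y\<close> has to avoid the range of \<open>P\<close>.\<close>

lemma ex_value_with_generic_multiples:
  fixes N :: nat and d :: "'k \<Rightarrow> real"
  assumes P: "partial_mon G K P" and small: "|fst ` P| <o |Pow K|" and inf: "infinite K"
    and x: "x \<in> carrier G" and N: "\<forall>k\<in>{1..N}. x [^]\<^bsub>G\<^esub> k \<notin> fst ` P"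
  shows "\<exists>y R m c. (\<forall>i\<in>K. \<bar>y i - d i\<bar> \<le> 2 / (real N + 1)) \<and>
    (\<forall>k\<in>R. \<forall>(a, u)\<in>P. \<not> (\<forall>i\<in>K. u i + real k * y i \<in> \<int>)) \<and>
    (\<forall>k\<in>R. x [^]\<^bsub>G\<^esub> k \<notin> fst ` P) \<and>
    ((m = 0 \<and> R = {1..}) \<or>
      (0 < m \<and> R = {1..<m} \<and> (x [^]\<^bsub>G\<^esub> m, c) \<in> P \<and> (\<forall>i\<in>K. real m * y i - c i \<in> \<int>)))"
proof (cases "\<exists>m>0. x [^]\<^bsub>G\<^esub> (m::nat) \<in> fst ` P")
  case False
  \<comment> \<open>No multiple of \<open>x\<close> has a prescribed value here, so the shift only
    has to be small and to have no positive multiple in the integers; any small irrational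
    serves.\<close>
  have "uncountable ({0<..<1 / (real N + 1)} - \<rat>)"
    by (intro uncountable_minus_countable countable_rat) (simp add: uncountable_open_interval)
  then obtain \<delta> where \<delta>: "0 < \<delta>" "\<delta> < 1 / (real N + 1)" "\<delta> \<notin> \<rat>"
    using uncountable_infinite by (metis DiffE ex_in_conv finite.emptyI greaterThanLessThan_iff)
  have irr: "\<forall>k\<in>{1..}. real k * \<delta> \<notin> \<int>"
  proof (intro ballI notI)
    fix k :: nat
    assume k: "k \<in> {1..}"
    assume "real k * \<delta> \<in> \<int>"
    then have "real k * \<delta> / real k \<in> \<rat>" using Ints_subset_Rats by (intro Rats_divide) auto
    then show False using k \<delta>(3) by simp
  qed
  obtain A where A: "\<forall>k\<in>{1..}. \<forall>(a, u)\<in>P.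
      \<not> (\<forall>i\<in>K. u i + real k * (d i + (if i \<in> A then \<delta> else 0)) \<in> \<int>)"
    using ex_generic_shift[where R = "{1..}" and y = d, OF P small inf irr] by (elim exE)
  have "\<forall>i\<in>K. \<bar>d i + (if i \<in> A then \<delta> else 0) - d i\<bar> \<le> 2 / (real N + 1)"
  proof
    fix i
    have "\<delta> \<le> 2 / (real N + 1)" using \<delta>(2) by (rule order.trans[OF less_imp_le]) (simp add: divide_right_mono)
    then show "\<bar>d i + (if i \<in> A then \<delta> else 0) - d i\<bar> \<le> 2 / (real N + 1)" using \<delta>(1) by simp
  qed
  moreover have "\<forall>k\<in>{1..}. x [^]\<^bsub>G\<^esub> (k::nat) \<notin> fst ` P"
  proof
    fix k :: nat assume "k \<in> {1..}"
    then have "0 < k" by simp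
    then show "x [^]\<^bsub>G\<^esub> k \<notin> fst ` P" using False by blast
  qed
  ultimately show ?thesis
    using A
    by (intro exI[of _ "\<lambda>i. d i + (if i \<in> A then \<delta> else 0)"] exI[of _ "{1..}"] exI[of _ 0]
        exI[of _ "\<lambda>_. 0"] conjI disjI1 refl)
next
  case True
  define m where "m = (LEAST m. 0 < m \<and> x [^]\<^bsub>G\<^esub> (m::nat) \<in> fst ` P)"
  have m: "0 < m" "x [^]\<^bsub>G\<^esub> m \<in> fst ` P"
    using LeastI_ex[OF True] unfolding m_def by blast+
  have least: "\<forall>k\<in>{1..<m}. x [^]\<^bsub>G\<^esub> k \<notin> fst ` P"
    using not_less_Least[of _ "\<lambda>m. 0 < m \<and> x [^]\<^bsub>G\<^esub> (m::nat) \<in> fst ` P"]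
    unfolding m_def by fastforce
  have Nm: "N < m"
  proof (rule ccontr)
    assume "\<not> N < m"
    then have "m \<in> {1..N}" using m(1) by simp
    with N m(2) show False by blast
  qed
  obtain c where c: "(x [^]\<^bsub>G\<^esub> m, c) \<in> P" using m(2) by auto
  \<comment> \<open>Among the solutions of \<open>m * t = c i\<close> modulo 1, \<open>y0 i\<close>
    is the largest one not exceeding \<open>d i\<close>, and adding \<open>1 / m\<close> leads to
    the next one. Either choice is compatible with \<open>c\<close> and lies within
    \<open>1 / m\<close> of \<open>d i\<close>.\<close>
  define y0 where "y0 i = (c i + of_int \<lfloor>real m * d i - c i\<rfloor>) / real m" for i
  have irr: "\<forall>k\<in>{1..<m}. real k * (1 / real m) \<notin> \<int>"
  proof (intro ballI notI)
    fix k :: nat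
    assume k: "k \<in> {1..<m}"
    assume "real k * (1 / real m) \<in> \<int>"
    then obtain z :: int where z: "real k / real m = of_int z" by (auto elim: Ints_cases)
    have "0 < real k / real m" "real k / real m < 1" using k by auto
    then show False unfolding z by simp
  qed
  obtain A where A: "\<forall>k\<in>{1..<m}. \<forall>(a, u)\<in>P.
      \<not> (\<forall>i\<in>K. u i + real k * (y0 i + (if i \<in> A then 1 / real m else 0)) \<in> \<int>)"
    using ex_generic_shift[where R = "{1..<m}" and y = y0, OF P small inf irr] by (elim exE)
  define y where "y i = y0 i + (if i \<in> A then 1 / real m else 0)" for i
  have my: "real m * y i = c i + of_int \<lfloor>real m * d i - c i\<rfloor> + (if i \<in> A then 1 else 0)" for i
    using m(1) by (simp add: y_def y0_def field_simps)
  have "\<forall>i\<in>K. \<bar>y i - d i\<bar> \<le> 2 / (real N + 1)"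
  proof
    fix i
    have "\<bar>real m * (y i - d i)\<bar> \<le> 2"
      unfolding right_diff_distrib my by (simp add: abs_le_iff) linarith
    then have "\<bar>y i - d i\<bar> \<le> 2 / real m"
      using m(1) by (simp only: abs_mult abs_of_nat) (simp add: pos_le_divide_eq mult.commute)
    also have "\<dots> \<le> 2 / (real N + 1)" using Nm by (intro divide_left_mono) auto
    finally show "\<bar>y i - d i\<bar> \<le> 2 / (real N + 1)" .
  qed
  moreover have "\<forall>i\<in>K. real m * y i - c i \<in> \<int>" unfolding my by auto
  ultimately show ?thesis
    using A[folded y_def] least m(1) c
    by (intro exI[of _ y] exI[of _ "{1..<m}"] exI[of _ m] exI[of _ c] conjI disjI2 refl)
qed

text \<open>New elements have the form \<open>(a, u) (x, y)^k\<close> with \<open>(a, u)\<close> in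
  \<open>P\<close>. If \<open>x\<close> has finite order \<open>m\<close> modulo the domain,
  division of \<open>k\<close> by \<open>m\<close> moves the multiple of \<open>m\<close> into
  \<open>P\<close>, where the value is already prescribed. For a remainder in \<open>R\<close>
  neither side of the defining equivalence holds.\<close>

lemma partial_mon_extend:
  fixes N :: nat and d :: "'k \<Rightarrow> real"
  assumes P: "partial_mon G K P" and small: "|fst ` P| <o |Pow K|" and inf: "infinite K"
    and x: "x \<in> carrier G" and N: "\<forall>k\<in>{1..N}. x [^]\<^bsub>G\<^esub> k \<notin> fst ` P"
  shows "\<exists>y. (\<forall>i\<in>K. \<bar>y i - d i\<bar> \<le> 2 / (real N + 1)) \<and>
    partial_mon G K (generate (G \<times>\<times> real_functions) (insert (x, y) P))"
proof -
  obtain y R m c where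
    y: "\<forall>i\<in>K. \<bar>y i - d i\<bar> \<le> 2 / (real N + 1)" and
    R: "\<forall>k\<in>R. \<forall>(a, u)\<in>P. \<not> (\<forall>i\<in>K. u i + real k * y i \<in> \<int>)"
      "\<forall>k\<in>R. x [^]\<^bsub>G\<^esub> k \<notin> fst ` P" and
    m: "(m = 0 \<and> R = {1..}) \<or>
      (0 < m \<and> R = {1..<m} \<and> (x [^]\<^bsub>G\<^esub> m, c) \<in> P \<and> (\<forall>i\<in>K. real m * y i - c i \<in> \<int>))"
    using ex_value_with_generic_multiples[OF P small inf x N, of d] by (elim exE conjE)
  \<comment> \<open>For \<open>r = 0\<close> this is the condition on \<open>P\<close>. For
    \<open>r\<close> in \<open>R\<close> both sides fail: the left one would put a power of
    \<open>x\<close> into the domain, the right one contradicts the choice of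
    \<open>y\<close>.\<close>
  have core: "a \<otimes>\<^bsub>G\<^esub> x [^]\<^bsub>G\<^esub> r = \<one>\<^bsub>G\<^esub> \<longleftrightarrow> (\<forall>i\<in>K. u i + real r * y i \<in> \<int>)"
    if "r \<in> insert 0 R" and au: "(a, u) \<in> P" for r a u
  proof (cases "r = 0")
    case True
    then show ?thesis using partial_mon_iff[OF P au] partial_mon_carrier[OF P au] by simp
  next
    case False
    then have r: "r \<in> R" using that(1) by simp
    have a: "a \<in> carrier G" using partial_mon_carrier[OF P au] .
    have "a \<otimes>\<^bsub>G\<^esub> x [^]\<^bsub>G\<^esub> r \<noteq> \<one>\<^bsub>G\<^esub>"
    proof
      assume "a \<otimes>\<^bsub>G\<^esub> x [^]\<^bsub>G\<^esub> r = \<one>\<^bsub>G\<^esub>"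
      then have "x [^]\<^bsub>G\<^esub> r = inv\<^bsub>G\<^esub> a" using a x inv_equality inv_inv by (metis inv_closed nat_pow_closed)
      then show False using R(2) r partial_mon_inv[OF P au] by force
    qed
    then show ?thesis using R(1) r au by blast
  qed
  have iff: "a \<otimes>\<^bsub>G\<^esub> x [^]\<^bsub>G\<^esub> k = \<one>\<^bsub>G\<^esub> \<longleftrightarrow> (\<forall>i\<in>K. u i + of_int k * y i \<in> \<int>)"
    if au: "(a, u) \<in> P" for a u and k :: int
  proof (cases "m = 0")
    case True
    have a: "a \<in> carrier G" using partial_mon_carrier[OF P au] .
    show ?thesis
    proof (cases k rule: int_cases2)
      case (nonneg n)
      have "n \<in> insert 0 R" using m True by auto
      from core[OF this au] show ?thesis using nonneg by (simp add: int_pow_int)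
    next
      \<comment> \<open>Since \<open>core\<close> covers natural exponents only, both sides are
        inverted and \<open>core\<close> is applied to the inverse of \<open>(a, u)\<close>.\<close>
      case (nonpos n)
      have n: "n \<in> insert 0 R" using m True by auto
      have "a \<otimes>\<^bsub>G\<^esub> x [^]\<^bsub>G\<^esub> k = \<one>\<^bsub>G\<^esub> \<longleftrightarrow> a = x [^]\<^bsub>G\<^esub> n"
        using inv_solve_right[of "\<one>\<^bsub>G\<^esub>" a "x [^]\<^bsub>G\<^esub> n"] a x nonpos
        by (auto simp: int_pow_neg_int)
      also have "\<dots> \<longleftrightarrow> inv\<^bsub>G\<^esub> a \<otimes>\<^bsub>G\<^esub> x [^]\<^bsub>G\<^esub> n = \<one>\<^bsub>G\<^esub>"
        using inv_solve_left[of "\<one>\<^bsub>G\<^esub>" a "x [^]\<^bsub>G\<^esub> n"] a x by auto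
      also have "\<dots> \<longleftrightarrow> (\<forall>i\<in>K. - u i + real n * y i \<in> \<int>)"
        by (rule core[OF n partial_mon_inv[OF P au]])
      also have "\<dots> \<longleftrightarrow> (\<forall>i\<in>K. - (u i + of_int k * y i) \<in> \<int>)"
        using nonpos by simp
      finally show ?thesis unfolding minus_in_Ints_iff .
    qed
  next
    case False
    have a: "a \<in> carrier G" using partial_mon_carrier[OF P au] .
    have M: "0 < m" "R = {1..<m}" "(x [^]\<^bsub>G\<^esub> m, c) \<in> P" "\<forall>i\<in>K. real m * y i - c i \<in> \<int>"
      using m False by auto
    define q where "q = k div int m"
    define r where "r = nat (k mod int m)"
    have k: "k = int m * q + int r" using M(1) by (simp add: q_def r_def)
    have r: "r \<in> insert 0 R" using M(1,2) by (auto simp: r_def nat_less_iff)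
    have P': "(a \<otimes>\<^bsub>G\<^esub> x [^]\<^bsub>G\<^esub> (int m * q), \<lambda>i. u i + of_int q * c i) \<in> P"
      using partial_mon_mult[OF P au partial_mon_int_pow[OF P M(3), of q]] x
      by (simp add: int_pow_pow flip: int_pow_int)
    have "a \<otimes>\<^bsub>G\<^esub> x [^]\<^bsub>G\<^esub> k = a \<otimes>\<^bsub>G\<^esub> x [^]\<^bsub>G\<^esub> (int m * q) \<otimes>\<^bsub>G\<^esub> x [^]\<^bsub>G\<^esub> r"
      unfolding k using a x by (simp add: int_pow_mult m_assoc flip: int_pow_int)
    then have "a \<otimes>\<^bsub>G\<^esub> x [^]\<^bsub>G\<^esub> k = \<one>\<^bsub>G\<^esub> \<longleftrightarrow>
        (\<forall>i\<in>K. u i + of_int q * c i + real r * y i \<in> \<int>)"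
      using core[OF r P'] by simp
    also have "\<dots> \<longleftrightarrow> (\<forall>i\<in>K. u i + of_int k * y i \<in> \<int>)"
    proof (intro ball_cong refl)
      fix i assume "i \<in> K"
      then have "of_int q * (real m * y i - c i) \<in> \<int>" using M(4) by (intro Ints_mult) auto
      moreover have "u i + of_int k * y i =
          (u i + of_int q * c i + real r * y i) + of_int q * (real m * y i - c i)"
        unfolding k by (simp add: algebra_simps)
      ultimately show "u i + of_int q * c i + real r * y i \<in> \<int> \<longleftrightarrow> u i + of_int k * y i \<in> \<int>"
        using Ints_add Ints_diff by (metis add_diff_cancel_right')
    qed
    finally show ?thesis .
  qed
  let ?GR = "G \<times>\<times> (real_functions :: ('k \<Rightarrow> real) monoid)"
  \<comment> \<open>In an abelian group the product of two subgroups is a subgroup; this supplies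
    the normal form \<open>(a, u) (x, y)^k\<close> of every generated element.\<close>
  let ?Q = "P <#>\<^bsub>?GR\<^esub> generate ?GR {(x, y)}"
  have sub: "subgroup P ?GR" using P unfolding partial_mon_def by blast
  have xy: "(x, y) \<in> carrier ?GR" using x by simp
  have subQ: "subgroup ?Q ?GR"
    using sub xy by (intro GR.mult_subgroups GR.generate_is_subgroup) auto
  have one: "\<one>\<^bsub>?GR\<^esub> \<in> P" using sub by (rule subgroup.one_closed)
  have "insert (x, y) P \<subseteq> ?Q"
  proof (intro insert_subsetI subsetI)
    show "(x, y) \<in> ?Q"
      using one xy generate.incl[of "(x, y)" "{(x, y)}" ?GR] GR.l_one[OF xy]
      unfolding set_mult_def by force
    fix p assume p: "p \<in> P"
    show "p \<in> ?Q"
      unfolding set_mult_def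
      by (intro UN_I[OF p] UN_I[OF generate.one])
        (simp only: GR.r_one[OF subgroup.mem_carrier[OF sub p]] singleton_iff)
  qed
  then have incl: "generate ?GR (insert (x, y) P) \<subseteq> ?Q"
    by (rule GR.generate_subgroup_incl[OF _ subQ])
  have "partial_mon G K (generate ?GR (insert (x, y) P))"
    unfolding partial_mon_def
  proof (intro conjI ballI, goal_cases)
    case 1
    show ?case
      using xy subgroup.subset[OF sub] by (intro GR.generate_is_subgroup) auto
  next
    case (2 p)
    then have "p \<in> ?Q" using incl by blast
    then obtain a u k where au: "(a, u) \<in> P" and p: "p = (a, u) \<otimes>\<^bsub>?GR\<^esub> (x, y) [^]\<^bsub>?GR\<^esub> (k::int)"
      unfolding set_mult_def GR.generate_pow[OF xy] by auto
    show ?case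
      using iff[OF au, of k] unfolding p int_pow_DirProd_real_functions[OF is_group x] by simp
  qed
  then show ?thesis using y by blast
qed

section \<open>Transfinite iteration of the extension step\<close>

text \<open>The condition concerns one pair at a time, so it survives increasing unions.
  \<open>T v\<close> is the stage up to and including \<open>v\<close>; each element of
  \<open>S U\<close> already lies in \<open>P0\<close> or in one such stage, so successor and limit
  positions need no separate treatment.\<close>

lemma partial_mon_chain:
  fixes W U :: "'w set" and f :: "'w \<Rightarrow> 'g \<times> ('k \<Rightarrow> real)" and P0
  defines "S \<equiv> \<lambda>U. generate (G \<times>\<times> real_functions) (P0 \<union> f ` U)"
  assumes P0: "partial_mon G K P0" and U: "U \<subseteq> W" and f: "f ` U \<subseteq> carrier (G \<times>\<times> real_functions)"
    and S: "\<And>v. v \<in> U \<Longrightarrow> partial_mon G K (generate (G \<times>\<times> real_functions) (insert (f v) (S (underS |W| v))))"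
  shows "partial_mon G K (S U)"
proof -
  let ?GR = "G \<times>\<times> (real_functions :: ('k \<Rightarrow> real) monoid)"
  have sub: "subgroup P0 ?GR" using P0 unfolding partial_mon_def by blast
  have gen: "P0 \<union> f ` U \<subseteq> carrier ?GR" using subgroup.subset[OF sub] f by blast
  have wo: "Well_order |W|" by (rule card_of_Well_order)
  have F: "Field |W| = W" by (rule Field_card_of)
  define T where "T v = S (insert v (underS |W| v))" for v
  have T_mono: "T v \<subseteq> T w" if "v \<in> underS |W| w" for v w
  proof -
    have W: "trans |W|" "antisym |W|"
      using wo unfolding well_order_on_def linear_order_on_def partial_order_on_def preorder_on_def by auto
    have "u \<in> underS |W| w" if u: "u \<in> underS |W| v" for u
    proof -
      have "(u, v) \<in> |W|" "(v, w) \<in> |W|" "v \<noteq> w"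
        using u \<open>v \<in> underS |W| w\<close> by (auto simp: underS_def)
      then show ?thesis
        using transD[OF W(1)] antisymD[OF W(2), of v w] by (auto simp: underS_def)
    qed
    then have "insert v (underS |W| v) \<subseteq> insert w (underS |W| w)" using that by auto
    then show ?thesis unfolding T_def S_def by (intro GR.mono_generate) blast
  qed
  have P0T: "P0 \<subseteq> T v" for v unfolding T_def S_def by (auto intro: generate.incl)
  have T_mult: "a \<otimes>\<^bsub>?GR\<^esub> b \<in> T v" if "a \<in> T v" "b \<in> T v" for a b v
    using that unfolding T_def S_def by (rule generate.eng)
  have total: "v = w \<or> v \<in> underS |W| w \<or> w \<in> underS |W| v" if "v \<in> U" "w \<in> U" for v w
    using wo that U F unfolding well_order_on_def linear_order_on_def total_on_def underS_def by blast
  \<comment> \<open>Two factors from different stages both lie in the later one, because the stages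
    are nested and the order is total. The alternative \<open>P0\<close> also takes care of empty
    \<open>U\<close>.\<close>
  have cover: "z \<in> P0 \<or> (\<exists>v\<in>U. z \<in> T v)" if "z \<in> S U" for z
    using that unfolding S_def
  proof induction
    case one
    then show ?case using subgroup.one_closed[OF sub] by blast
  next
    case (incl h)
    then show ?case unfolding T_def S_def by (auto intro: generate.incl)
  next
    case (inv h)
    then show ?case unfolding T_def S_def by (auto intro: generate.inv subgroup.m_inv_closed[OF sub])
  next
    case (eng a b)
    consider "a \<in> P0" "b \<in> P0" | v where "v \<in> U" "a \<in> T v" "b \<in> P0" | v where "v \<in> U" "a \<in> P0" "b \<in> T v"
      | v w where "v \<in> U" "w \<in> U" "a \<in> T v" "b \<in> T w"
      using eng.IH by blast
    then show ?case
    proof cases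
      case 1
      then show ?thesis using subgroup.m_closed[OF sub] by blast
    next
      case 2
      then show ?thesis using T_mult P0T by blast
    next
      case 3
      then show ?thesis using T_mult P0T by blast
    next
      case 4
      then show ?thesis using T_mult T_mono total by blast
    qed
  qed
  have T_sub: "T v \<subseteq> generate ?GR (insert (f v) (S (underS |W| v)))" if v: "v \<in> U" for v
    unfolding T_def S_def
  proof (rule GR.generate_subgroup_incl)
    show "subgroup (generate ?GR (insert (f v) (generate ?GR (P0 \<union> f ` underS |W| v)))) ?GR"
      using S[OF v] unfolding partial_mon_def S_def by blast
    show "P0 \<union> f ` insert v (underS |W| v)
        \<subseteq> generate ?GR (insert (f v) (generate ?GR (P0 \<union> f ` underS |W| v)))"
      by (auto intro!: generate.incl)
  qed
  show ?thesis
    unfolding partial_mon_def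
  proof (intro conjI ballI, goal_cases)
    case 1
    show ?case unfolding S_def by (rule GR.generate_is_subgroup[OF gen])
  next
    case (2 z)
    then consider "z \<in> P0" | v where "v \<in> U" "z \<in> generate ?GR (insert (f v) (S (underS |W| v)))"
      using cover T_sub by blast
    then show ?case
    proof cases
      case 1
      then show ?thesis using P0 unfolding partial_mon_def by blast
    next
      case 2
      then show ?thesis using S[OF 2(1)] unfolding partial_mon_def by blast
    qed
  qed
qed

text \<open>Each \<open>w\<close> is a task: put into the domain an element satisfying
  \<open>Q w\<close>, with value close to \<open>d w\<close>. The same scheme later serves for
  density, with targets and precisions as tasks, and for the extension to \<open>G\<close>, with the
  elements of \<open>G\<close> as tasks.\<close>

lemma partial_mon_transfinite_extend:
  fixes W :: "'w set" and Z :: "'z set" and N :: "'w \<Rightarrow> nat" and d :: "'w \<Rightarrow> 'k \<Rightarrow> real"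
    and Q :: "'w \<Rightarrow> 'g \<Rightarrow> bool"
  assumes P0: "partial_mon G K P0" and small: "|fst ` P0| <o |Z|"
    and Z: "|UNIV :: nat set| <o |Z|" "|Z| \<le>o |Pow K|" and inf: "infinite K" and W: "|W| \<le>o |Z|"
    and step: "\<And>w H. w \<in> W \<Longrightarrow> |H| <o |Z| \<Longrightarrow>
      \<exists>x\<in>carrier G. Q w x \<and> (\<forall>k\<in>{1..N w}. x [^]\<^bsub>G\<^esub> k \<notin> H)"
  shows "\<exists>P. partial_mon G K P \<and> P0 \<subseteq> P \<and> |fst ` P| \<le>o |Z| \<and>
    (\<forall>w\<in>W. \<exists>x u. Q w x \<and> (x, u) \<in> P \<and> (\<forall>i\<in>K. \<bar>u i - d w i\<bar> \<le> 2 / (real (N w) + 1)))"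
proof -
  let ?GR = "G \<times>\<times> (real_functions :: ('k \<Rightarrow> real) monoid)"
  let ?S = "\<lambda>f U. generate ?GR (P0 \<union> f ` U)"
  \<comment> \<open>This is the demand on the choice \<open>r\<close> at \<open>w\<close>, given the
    earlier values of \<open>f\<close>. Outside \<open>W\<close> nothing is demanded, so that the
    recursion can run over the whole type.\<close>
  define ok where "ok f w r \<longleftrightarrow> (w \<in> W \<longrightarrow> fst r \<in> carrier G \<and> Q w (fst r) \<and>
      (\<forall>i\<in>K. \<bar>snd r i - d w i\<bar> \<le> 2 / (real (N w) + 1)) \<and>
      partial_mon G K (generate ?GR (insert r (?S f (underS |W| w)))))"
    for f :: "'w \<Rightarrow> 'g \<times> ('k \<Rightarrow> real)" and w r
  have P0_carrier: "P0 \<subseteq> carrier ?GR"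
    using P0 unfolding partial_mon_def by (intro subgroup.subset) blast
  have infZ: "infinite Z"
    using ordLess_imp_ordLeq[OF Z(1)] infinite_iff_card_of_nat by blast
  have underS: "z \<in> underS |W| w \<Longrightarrow> z \<in> W" for z w
    using Field_card_of[of W] unfolding underS_def Field_def by blast
  have "\<exists>f. \<forall>w. ok f w (f w)"
  proof (rule dependent_wf_choice)
    show "wf ( |W| - Id)"
      using card_of_Well_order[of W] unfolding well_order_on_def by blast
  next
    fix f g :: "'w \<Rightarrow> 'g \<times> ('k \<Rightarrow> real)" and w r
    assume "\<And>z. (z, w) \<in> |W| - Id \<Longrightarrow> f z = g z"
    then have "f ` underS |W| w = g ` underS |W| w"
      by (intro image_cong) (auto simp: underS_def)
    then show "ok f w r = ok g w r" unfolding ok_def by simp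
  next
    fix w and f :: "'w \<Rightarrow> 'g \<times> ('k \<Rightarrow> real)"
    assume IH: "\<And>v. (v, w) \<in> |W| - Id \<Longrightarrow> ok f v (f v)"
    show "\<exists>r. ok f w r"
    proof (cases "w \<in> W")
      case False
      then show ?thesis by (simp add: ok_def)
    next
      case True
      let ?U = "underS |W| w"
      have ok: "ok f v (f v)" if "v \<in> ?U" for v
        using that by (intro IH) (auto simp: underS_def)
      have fU: "f ` ?U \<subseteq> carrier ?GR"
        using ok underS by (fastforce simp: ok_def mem_Times_iff)
      have pm: "partial_mon G K (?S f ?U)"
        using P0 _ fU
      proof (rule partial_mon_chain)
        show "?U \<subseteq> W" using underS by blast
        show "partial_mon G K (generate ?GR (insert (f v) (?S f (underS |W| v))))" if "v \<in> ?U" for v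
          using ok[OF that] underS[OF that] unfolding ok_def by blast
      qed
      \<comment> \<open>The relation \<open>|W|\<close> is a cardinal well-order, so its proper
        initial segments are smaller than \<open>W\<close>. Hence fewer than \<open>|Z|\<close>
        elements generate the current domain, and \<open>step\<close> applies to it.\<close>
      have "|?U| <o |Z|"
        using card_of_underS[OF card_of_Card_order, of w W] True W
        by (metis Field_card_of ordLess_ordLeq_trans)
      then have "|fst ` P0 \<union> fst ` f ` ?U| <o |Z|"
        by (intro card_of_Un_ordLess_infinite infZ small ordLeq_ordLess_trans[OF card_of_image])
      then have "|generate G (fst ` (P0 \<union> f ` ?U))| <o |Z|"
        using P0_carrier fU
        by (intro card_of_generate_less Z(1) is_group) (auto simp: image_Un)
      with fst_generate_DirProd[OF is_group RF.is_group Un_least[OF P0_carrier fU]]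
      have less: "|fst ` ?S f ?U| <o |Z|"
        by (rule ordLeq_ordLess_trans[OF card_of_mono1])
      obtain x where x: "x \<in> carrier G" "Q w x" "\<forall>k\<in>{1..N w}. x [^]\<^bsub>G\<^esub> k \<notin> fst ` ?S f ?U"
        using step[OF True less] by blast
      obtain y where y: "\<forall>i\<in>K. \<bar>y i - d w i\<bar> \<le> 2 / (real (N w) + 1)"
        "partial_mon G K (generate ?GR (insert (x, y) (?S f ?U)))"
        using partial_mon_extend[OF pm ordLess_ordLeq_trans[OF less Z(2)] inf x(1,3), of "d w"]
        by blast
      show ?thesis
        using x(1,2) y by (intro exI[of _ "(x, y)"]) (simp add: ok_def)
    qed
  qed
  then obtain f where f: "\<And>w. ok f w (f w)" by blast
  let ?P = "?S f W"
  have fW: "f ` W \<subseteq> carrier ?GR"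
    using f by (fastforce simp: ok_def mem_Times_iff)
  have pm: "partial_mon G K ?P"
    using P0 _ fW
  proof (rule partial_mon_chain)
    show "partial_mon G K (generate ?GR (insert (f v) (?S f (underS |W| v))))" if "v \<in> W" for v
      using f[of v] that unfolding ok_def by blast
  qed simp
  have "|fst ` P0 \<union> fst ` f ` W| \<le>o |Z|"
    using W by (intro card_of_Un_le card_of_image_le infZ ordLess_imp_ordLeq[OF small])
  then have "|generate G (fst ` (P0 \<union> f ` W))| \<le>o |Z|"
    using P0_carrier fW
    by (intro card_of_generate_le infZ is_group) (auto simp: image_Un)
  with fst_generate_DirProd[OF is_group RF.is_group Un_least[OF P0_carrier fW]]
  have "|fst ` ?P| \<le>o |Z|"
    by (rule ordLeq_transitive[OF card_of_mono1])
  moreover have "P0 \<subseteq> ?P" by (auto intro: generate.incl)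
  moreover have "\<exists>x u. Q w x \<and> (x, u) \<in> ?P \<and> (\<forall>i\<in>K. \<bar>u i - d w i\<bar> \<le> 2 / (real (N w) + 1))"
    if "w \<in> W" for w
  proof (intro exI conjI)
    show "Q w (fst (f w))" "\<forall>i\<in>K. \<bar>snd (f w) i - d w i\<bar> \<le> 2 / (real (N w) + 1)"
      using f[of w] that unfolding ok_def by blast+
    show "(fst (f w), snd (f w)) \<in> ?P" using that by (auto intro: generate.incl)
  qed
  ultimately show ?thesis using pm by blast
qed

end

section \<open>Dense subsets of a power of the circle\<close>

lemma circle_proj_eq: "circle_proj x = {z + x | z. z \<in> \<int>}"
  by (auto simp: circle_proj_def r_coset_def real_group_def)

lemma circle_proj_eq_iff: "circle_proj x = circle_proj y \<longleftrightarrow> x - y \<in> \<int>"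
proof
  assume "circle_proj x = circle_proj y"
  moreover have "x \<in> circle_proj x" unfolding circle_proj_eq by (auto intro: exI[of _ 0])
  ultimately show "x - y \<in> \<int>" unfolding circle_proj_eq by auto
next
  have sub: "circle_proj u \<subseteq> circle_proj v" if "u - v \<in> \<int>" for u v
  proof
    fix w assume "w \<in> circle_proj u"
    then obtain z where "z \<in> \<int>" "w = z + u" unfolding circle_proj_eq by auto
    then show "w \<in> circle_proj v"
      unfolding circle_proj_eq using that by (auto intro!: exI[of _ "z + (u - v)"])
  qed
  assume xy: "x - y \<in> \<int>"
  then have "y - x \<in> \<int>" using Ints_minus by fastforce
  with xy show "circle_proj x = circle_proj y" using sub by blast
qed

lemma circle_group_mult:
  "circle_proj x \<otimes>\<^bsub>circle_group\<^esub> circle_proj y = circle_proj (x + y)"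
proof -
  have "x + y = x \<otimes>\<^bsub>real_group\<^esub> y" by (simp add: real_group_def)
  then show ?thesis
    using normal.rcos_sum[OF normal_Ints, of x y]
    by (simp add: circle_group_def circle_proj_def FactGroup_def real_group_def)
qed

lemma circle_group_one: "\<one>\<^bsub>circle_group\<^esub> = circle_proj 0"
  by (simp add: circle_group_def FactGroup_def circle_proj_eq)

text \<open>The preimage of the image of \<open>U\<close> is the union of the integer translates of
  \<open>U\<close>, so the projection is an open map.\<close>

lemma openin_circle_proj_image:
  assumes "open U"
  shows "openin circle_topology (circle_proj ` U)"
proof -
  have "{x. circle_proj x \<in> circle_proj ` U} = (\<Union>z\<in>\<int>. (+) z ` U)"
  proof (intro equalityI subsetI)
    fix x assume "x \<in> {x. circle_proj x \<in> circle_proj ` U}"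
    then obtain y where "y \<in> U" "x - y \<in> \<int>" by (auto simp: circle_proj_eq_iff)
    then show "x \<in> (\<Union>z\<in>\<int>. (+) z ` U)" by (intro UN_I[of "x - y"]) (auto intro: image_eqI[of _ _ y])
  next
    fix x assume "x \<in> (\<Union>z\<in>\<int>. (+) z ` U)"
    then obtain z y where "z \<in> \<int>" "y \<in> U" "x = z + y" by auto
    then have "circle_proj x = circle_proj y" by (simp add: circle_proj_eq_iff)
    then show "x \<in> {x. circle_proj x \<in> circle_proj ` U}" using \<open>y \<in> U\<close> by simp
  qed
  then show ?thesis
    using assms by (auto simp: openin_circle_topology carrier_circle_group intro: open_translation)
qed

section \<open>Density in the torus and its cardinality\<close>

text \<open>A basic open set of the product restricts finitely many coordinates, and each
  restriction can be shrunk to the image of a real interval. This phrases density in the real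
  representatives used by partial monomorphisms.\<close>

lemma dense_torus_iff:
  assumes D: "D \<subseteq> carrier (torus_group \<kappa>)"
  shows "torus_topology \<kappa> closure_of D = topspace (torus_topology \<kappa>) \<longleftrightarrow>
    (\<forall>F p \<epsilon>. finite F \<longrightarrow> F \<subseteq> Field \<kappa> \<longrightarrow> 0 < \<epsilon> \<longrightarrow>
      (\<exists>x\<in>D. \<forall>i\<in>F. \<exists>t. \<bar>t - p i\<bar> < \<epsilon> \<and> x i = circle_proj t))"
    (is "?dense \<longleftrightarrow> ?approx")
proof
  assume dense: ?dense
  show ?approx
  proof (intro allI impI)
    fix F :: "'a set" and p :: "'a \<Rightarrow> real" and \<epsilon> :: real
    assume F: "finite F" "F \<subseteq> Field \<kappa>" and "0 < \<epsilon>"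
    define V where "V i = (if i \<in> F then circle_proj ` {p i - \<epsilon><..<p i + \<epsilon>} else topspace circle_topology)" for i
    have "openin (torus_topology \<kappa>) (PiE (Field \<kappa>) V)"
      unfolding torus_topology_def
    proof (rule product_topology_basis)
      show "openin circle_topology (V i)" for i by (simp add: V_def openin_circle_proj_image)
      show "finite {i. V i \<noteq> topspace circle_topology}"
        by (rule finite_subset[OF _ F(1)]) (auto simp: V_def)
    qed
    moreover have "circle_proj (p i) \<in> V i" for i
      using \<open>0 < \<epsilon>\<close> by (auto simp: V_def topspace_circle_topology carrier_circle_group)
    then have "PiE (Field \<kappa>) V \<noteq> {}" unfolding PiE_eq_empty_iff by blast
    ultimately have "D \<inter> PiE (Field \<kappa>) V \<noteq> {}"
      using dense[unfolded dense_intersects_open, rule_format] by simp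
    then obtain x where x: "x \<in> D" "x \<in> PiE (Field \<kappa>) V" by blast
    have "\<exists>t. \<bar>t - p i\<bar> < \<epsilon> \<and> x i = circle_proj t" if i: "i \<in> F" for i
    proof -
      have "x i \<in> V i" using i x(2) F(2) by (auto simp: PiE_iff)
      then obtain t where "t \<in> {p i - \<epsilon><..<p i + \<epsilon>}" "x i = circle_proj t"
        using i by (auto simp: V_def)
      then show ?thesis by (intro exI[of _ t]) auto
    qed
    with x(1) show "\<exists>x\<in>D. \<forall>i\<in>F. \<exists>t. \<bar>t - p i\<bar> < \<epsilon> \<and> x i = circle_proj t" by blast
  qed
next
  assume approx: ?approx
  show ?dense
    unfolding dense_intersects_open
  proof (intro allI impI, elim conjE)
    fix U assume U: "openin (torus_topology \<kappa>) U" "U \<noteq> {}"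
    then obtain q where q: "q \<in> U" by blast
    obtain V where V: "q \<in> PiE (Field \<kappa>) V" "\<forall>i. openin circle_topology (V i)"
        "finite {i. V i \<noteq> topspace circle_topology}" "PiE (Field \<kappa>) V \<subseteq> U"
      using product_topology_open_contains_basis[OF U(1)[unfolded torus_topology_def] q]
      by (elim exE conjE)
    define F where "F = Field \<kappa> \<inter> {i. V i \<noteq> topspace circle_topology}"
    have F: "finite F" "F \<subseteq> Field \<kappa>" using V(3) by (auto simp: F_def)
    have "\<exists>t. q i = circle_proj t" if "i \<in> F" for i
    proof -
      have "q i \<in> V i" using that V(1) F(2) by (auto simp: PiE_iff)
      then show ?thesis
        using openin_subset[OF V(2)[rule_format, of i]] by (auto simp: topspace_circle_topology carrier_circle_group)
    qed
    then obtain p where p: "\<And>i. i \<in> F \<Longrightarrow> q i = circle_proj (p i)" by metis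
    have "\<exists>e>0. \<forall>t. \<bar>t - p i\<bar> < e \<longrightarrow> circle_proj t \<in> V i" if "i \<in> F" for i
    proof -
      have "open {x. circle_proj x \<in> V i}" using V(2) by (simp add: openin_circle_topology)
      moreover have "q i \<in> V i" using that V(1) F(2) by (auto simp: PiE_iff)
      then have "p i \<in> {x. circle_proj x \<in> V i}" by (simp add: p[OF that])
      ultimately show ?thesis unfolding open_dist dist_real_def by blast
    qed
    then obtain e where e: "\<And>i. i \<in> F \<Longrightarrow> 0 < e i"
        "\<And>i t. i \<in> F \<Longrightarrow> \<bar>t - p i\<bar> < e i \<Longrightarrow> circle_proj t \<in> V i" by metis
    \<comment> \<open>The extra 1 keeps the minimum meaningful when \<open>F\<close> is
      empty.\<close>
    define \<epsilon> where "\<epsilon> = Min (insert 1 (e ` F))"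
    have \<epsilon>: "0 < \<epsilon>" "\<And>i. i \<in> F \<Longrightarrow> \<epsilon> \<le> e i"
      using F(1) e(1) by (auto simp: \<epsilon>_def)
    obtain x where x: "x \<in> D" "\<forall>i\<in>F. \<exists>t. \<bar>t - p i\<bar> < \<epsilon> \<and> x i = circle_proj t"
      using approx[rule_format, OF F \<epsilon>(1), of p] by (elim bexE)
    have "x i \<in> V i" if "i \<in> Field \<kappa>" for i
    proof (cases "i \<in> F")
      case True
      then obtain t where "\<bar>t - p i\<bar> < \<epsilon>" "x i = circle_proj t" using x(2) by blast
      then show ?thesis using \<epsilon>(2)[OF True] e(2)[OF True, of t] by simp
    next
      case False
      then have "V i = carrier circle_group" using that by (simp add: F_def topspace_circle_topology)
      then show ?thesis using x(1) D that by (auto simp: torus_group_def PiE_iff)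
    qed
    moreover have "x \<in> extensional (Field \<kappa>)"
      using x(1) D by (auto simp: torus_group_def PiE_iff)
    ultimately have "x \<in> PiE (Field \<kappa>) V" by (simp add: PiE_iff)
    then have "x \<in> U" using V(4) by blast
    then show "D \<inter> U \<noteq> {}" using x(1) by blast
  qed
qed

text \<open>A point of the torus is determined by its graph, a subset of the product of the index
  set and the circle. That product is no larger than the index set, which has at least the size of
  the continuum.\<close>

lemma card_of_torus_le:
  assumes \<kappa>: "Card_order \<kappa>" and "|UNIV :: real set| <o \<kappa>"
  shows "|carrier (torus_group \<kappa>)| \<le>o ctwo ^c \<kappa>"
proof -
  let ?K = "Field \<kappa>" and ?C = "carrier circle_group"
  have real: "|UNIV :: real set| \<le>o |?K|"
    using ordLess_imp_ordLeq[OF ordLess_ordIso_trans[OF assms(2) ordIso_symmetric[OF card_of_Field_ordIso[OF \<kappa>]]]] .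
  then have inf: "infinite ?K"
    using card_of_ordLeq_infinite infinite_UNIV_char_0 by blast
  have "|?K \<times> ?C| \<le>o |?K|"
    unfolding carrier_circle_group by (intro card_of_Times_le inf card_of_image_le real card_of_refl ordIso_imp_ordLeq)
  then have "|Pow (?K \<times> ?C)| \<le>o |Pow ?K|" by (rule card_of_Pow_mono)
  moreover have "|PiE ?K (\<lambda>_. ?C)| \<le>o |Pow (?K \<times> ?C)|"
  proof (rule card_of_ordLeqI)
    show "inj_on (\<lambda>x. (\<lambda>i. (i, x i)) ` ?K) (PiE ?K (\<lambda>_. ?C))"
    proof (rule inj_onI)
      fix x y assume xy: "x \<in> PiE ?K (\<lambda>_. ?C)" "y \<in> PiE ?K (\<lambda>_. ?C)"
        "(\<lambda>i. (i, x i)) ` ?K = (\<lambda>i. (i, y i)) ` ?K"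
      have "x i = y i" if "i \<in> ?K" for i
      proof -
        have "(i, x i) \<in> (\<lambda>i. (i, y i)) ` ?K" unfolding xy(3)[symmetric] using that by (rule imageI)
        then show ?thesis by (auto simp only: image_iff prod.inject)
      qed
      then show "x = y" by (rule PiE_ext[OF xy(1,2)])
    qed
  qed (auto simp: PiE_iff)
  ultimately have "|PiE ?K (\<lambda>_. ?C)| \<le>o |Pow ?K|" using ordLeq_transitive by blast
  then show ?thesis
    unfolding torus_group_def carrier_product_group
    by (rule ordLeq_ordIso_trans[OF _ card_of_Pow_Field_cexp])
qed

text \<open>Two different coordinates of \<open>T\<^sup>\<kappa>\<close> are told apart by some \<open>y\<close> in the dense set \<open>n\<phi>(S)\<close>:
  \<open>y\<close> lies in \<open>(0, 1/2)\<close> in the first and in \<open>(1/2, 1)\<close> in the second.\<close>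

lemma card_le_Pow_multiples:
  fixes \<phi> :: "'g \<Rightarrow> 'k \<Rightarrow> real set"
  assumes G: "comm_group G" "S \<subseteq> carrier G" and \<phi>: "\<phi> \<in> hom G (torus_group \<kappa>)"
    and dense: "torus_topology \<kappa> closure_of (\<phi> ` S) = topspace (torus_topology \<kappa>)" and n: "0 < n"
  shows "|Field \<kappa>| \<le>o |Pow (multiples G n S)|"
proof (rule card_of_ordLeqI)
  let ?A = "\<lambda>\<alpha>. {y \<in> multiples G n S. \<exists>t. 0 < t \<and> t < 1/2 \<and> \<phi> y \<alpha> = circle_proj t}"
  interpret group_hom G "torus_group \<kappa>" \<phi>
    unfolding group_hom_def group_hom_axioms_def
    using \<phi> G(1) comm_group_circle_group by (simp add: torus_group_def comm_group.axioms(2))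
  have pow: "\<phi> (s [^]\<^bsub>G\<^esub> m) i = circle_proj (real m * t)"
    if "s \<in> carrier G" "i \<in> Field \<kappa>" "\<phi> s i = circle_proj t" for s i t and m :: nat
    using that
    by (induction m) (auto simp: torus_group_def circle_group_one circle_group_mult algebra_simps)
  show "inj_on ?A (Field \<kappa>)"
  proof (intro inj_onI, rule ccontr)
    fix \<alpha> \<beta> assume ab: "\<alpha> \<in> Field \<kappa>" "\<beta> \<in> Field \<kappa>" "?A \<alpha> = ?A \<beta>" "\<alpha> \<noteq> \<beta>"
    \<comment> \<open>With tolerance \<open>1 / (4 * n)\<close>, multiplication by \<open>n\<close>
      carries the two intervals onto \<open>(0, 1/2)\<close> and \<open>(1/2, 1)\<close>.\<close>
    let ?p = "\<lambda>i. if i = \<alpha> then 1 / (4 * real n) else 3 / (4 * real n)"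
    have sub: "\<phi> ` S \<subseteq> carrier (torus_group \<kappa>)" using G(2) by auto
    have "\<exists>x\<in>\<phi> ` S. \<forall>i\<in>{\<alpha>, \<beta>}. \<exists>t. \<bar>t - ?p i\<bar> < 1 / (4 * real n) \<and> x i = circle_proj t"
      using dense_torus_iff[OF sub, THEN iffD1, OF dense, rule_format, of "{\<alpha>, \<beta>}" "1 / (4 * real n)" ?p]
        ab(1,2) n by simp
    then obtain s t t' where s: "s \<in> S" and t: "\<bar>t - 1 / (4 * real n)\<bar> < 1 / (4 * real n)" "\<phi> s \<alpha> = circle_proj t"
      and t': "\<bar>t' - 3 / (4 * real n)\<bar> < 1 / (4 * real n)" "\<phi> s \<beta> = circle_proj t'"
      using ab(4) by auto
    have "0 < real n * t" "real n * t < 1/2" using t(1) n by (auto simp: abs_less_iff field_simps)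
    moreover have nt': "1/2 < real n * t'" "real n * t' < 1" using t'(1) n by (auto simp: abs_less_iff field_simps)
    moreover have "s [^]\<^bsub>G\<^esub> n \<in> multiples G n S" using s by (auto simp: multiples_def)
    ultimately have "s [^]\<^bsub>G\<^esub> n \<in> ?A \<alpha>" using pow[OF _ ab(1) t(2), of n] s G(2) by blast
    then have "s [^]\<^bsub>G\<^esub> n \<in> ?A \<beta>" using ab(3) by blast
    then obtain r where r: "0 < r" "r < 1/2" "circle_proj (real n * t') = circle_proj r"
      using pow[OF _ ab(2) t'(2), of n] s G(2) by auto
    then obtain z :: int where "real n * t' - r = of_int z" unfolding circle_proj_eq_iff by (auto elim: Ints_cases)
    \<comment> \<open>A number in \<open>(1/2, 1)\<close> and one in \<open>(0, 1/2)\<close> differ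
      by less than 1 and by more than 0, so they are not congruent modulo the integers.\<close>
    then have "0 < real_of_int z" "real_of_int z < 1" using nt' r(1,2) by linarith+
    then show False by simp
  qed
qed auto

section \<open>Wide sets\<close>

text \<open>If \<open>nS\<close> is smaller than \<tau>, one preimage for each of its elements forms
  a set \<open>S'\<close> of the same size that generates a subgroup containing \<open>nS\<close>.
  Conversely, as \<tau> is uncountable, fewer than \<tau> elements generate a subgroup too small to
  contain \<open>nS\<close>.\<close>

lemma wide_iff:
  fixes \<tau> :: "'t rel" and G :: "('g, 'm) monoid_scheme"
  assumes G: "group G" "S \<subseteq> carrier G" and \<tau>: "Card_order \<tau>" "|UNIV :: nat set| <o |Field \<tau>|"
  shows "wide G \<tau> S \<longleftrightarrow> (\<forall>n>0. \<tau> \<le>o |multiples G n S| )"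
proof
  have \<tau>_eq: "\<tau> =o |Field \<tau>|" by (rule ordIso_symmetric[OF card_of_Field_ordIso[OF \<tau>(1)]])
  show "\<forall>n>0. \<tau> \<le>o |multiples G n S|" if wide: "wide G \<tau> S"
  proof (intro allI impI)
    fix n :: nat assume n: "0 < n"
    let ?pow = "\<lambda>x. x [^]\<^bsub>G\<^esub> n"
    obtain S' where S': "S' \<subseteq> S" "inj_on ?pow S'" "?pow ` S' = multiples G n S"
      using subset_image_inj[of "multiples G n S" ?pow S] by (auto simp: multiples_def)
    show "\<tau> \<le>o |multiples G n S|"
    proof (rule ccontr)
      assume "\<not> \<tau> \<le>o |multiples G n S|"
      then have "|multiples G n S| <o \<tau>"
        using \<tau>(1) by (simp add: not_ordLeq_iff_ordLess card_of_Well_order card_order_on_well_order_on)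
      moreover have "|S'| \<le>o |multiples G n S|"
        using S' by (intro card_of_ordLeqI[of ?pow]) auto
      ultimately have "|S'| <o \<tau>" using ordLeq_ordLess_trans by blast
      then have "multiples G n S - generate G S' \<noteq> {}"
        using wide n S'(1) unfolding wide_def by blast
      moreover have "multiples G n S \<subseteq> generate G S'"
      proof -
        have "x [^]\<^bsub>G\<^esub> n \<in> generate G S'" if x: "x \<in> S'" for x
          using group.subgroup_int_pow_closed[OF G(1) group.generate_is_subgroup[OF G(1)] generate.incl[OF x], of "int n"]
            S'(1) G(2) by (simp add: int_pow_int)
        then show ?thesis unfolding S'(3)[symmetric] by blast
      qed
      ultimately show False by blast
    qed
  qed
  show "wide G \<tau> S" if large: "\<forall>n>0. \<tau> \<le>o |multiples G n S|"
    unfolding wide_def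
  proof (intro allI impI)
    fix n :: nat and S' assume n: "0 < n" and S': "S' \<subseteq> S" "|S'| <o \<tau>"
    have "|generate G S'| <o |Field \<tau>|"
      using S' G(2) by (intro card_of_generate_less G(1) \<tau>(2) ordLess_ordIso_trans[OF S'(2) \<tau>_eq]) auto
    then have "|generate G S'| <o |multiples G n S|"
      using ordLess_ordLeq_trans ordIso_ordLeq_trans[OF ordIso_symmetric[OF \<tau>_eq]] large n by blast
    then show "multiples G n S - generate G S' \<noteq> {}"
      using card_of_mono1 not_ordLess_ordLeq by (metis Diff_eq_empty_iff)
  qed
qed

section \<open>Construction of a dense monomorphism\<close>

text \<open>The Hewitt--Marczewski--Pondiczery construction: \<open>d (L, h) i\<close> depends only on which members
  of the finite list \<open>L\<close> belong to the set coding \<open>i\<close>.\<close>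

lemma ex_dense_targets:
  fixes K :: "'k set" and T :: "'t set"
  assumes "|K| \<le>o |Pow T|"
  shows "\<exists>d :: 't list \<times> (bool list \<times> rat) list \<Rightarrow> 'k \<Rightarrow> real.
    \<forall>F p \<epsilon>. finite F \<longrightarrow> F \<subseteq> K \<longrightarrow> 0 < \<epsilon> \<longrightarrow> (\<exists>w\<in>lists T \<times> UNIV. \<forall>i\<in>F. \<bar>d w i - p i\<bar> < \<epsilon>)"
proof -
  obtain e where e: "inj_on e K" "e ` K \<subseteq> Pow T" using assms card_of_ordLeq by metis
  define bits where "bits L i = map (\<lambda>t. t \<in> e i) L" for L :: "'t list" and i
  \<comment> \<open>The second component of \<open>w\<close> is a finite table from bit vectors to
    rationals. Lists and tables over \<open>T\<close> number at most \<open>|T|\<close> when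
    \<open>T\<close> is infinite. The default 0 is never read at a coordinate of \<open>F\<close>
    for the table built below.\<close>
  define d where "d w i = (case map_of (snd w) (bits (fst w) i) of None \<Rightarrow> 0 | Some q \<Rightarrow> real_of_rat q)"
    for w :: "'t list \<times> (bool list \<times> rat) list" and i
  have "\<exists>w\<in>lists T \<times> UNIV. \<forall>i\<in>F. \<bar>d w i - p i\<bar> < \<epsilon>"
    if F: "finite F" "F \<subseteq> K" and \<epsilon>: "0 < \<epsilon>" for F and p :: "'k \<Rightarrow> real" and \<epsilon>
  proof -
    have "\<exists>t\<in>T. t \<in> e i \<longleftrightarrow> t \<notin> e j" if ij: "i \<in> F" "j \<in> F" "i \<noteq> j" for i j
    proof -
      have "e i \<noteq> e j" using ij F(2) e(1) by (meson inj_on_def subsetD)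
      moreover have "e i \<subseteq> T" "e j \<subseteq> T" using ij F(2) e(2) by blast+
      ultimately show ?thesis by blast
    qed
    then obtain t where t: "\<And>i j. i \<in> F \<Longrightarrow> j \<in> F \<Longrightarrow> i \<noteq> j \<Longrightarrow> t i j \<in> T \<and> (t i j \<in> e i \<longleftrightarrow> t i j \<notin> e j)"
      by metis
    \<comment> \<open>One separating element for each pair of distinct coordinates: membership in
      these finitely many elements of \<open>T\<close> tells all coordinates of \<open>F\<close>
      apart.\<close>
    let ?M = "{t i j | i j. i \<in> F \<and> j \<in> F \<and> i \<noteq> j}"
    have "?M \<subseteq> (\<lambda>(i, j). t i j) ` (F \<times> F)" by auto
    then have "finite ?M" by (rule finite_subset) (simp add: F(1))
    then have "\<exists>L. set L = ?M" by (rule finite_list)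
    then obtain L where L: "set L = ?M" by (elim exE)
    have LT: "L \<in> lists T" using L t by (auto simp: in_lists_conv_set)
    have bits_inj: "i = j" if "i \<in> F" "j \<in> F" "bits L i = bits L j" for i j
    proof (rule ccontr)
      assume "i \<noteq> j"
      then have "t i j \<in> set L" using that unfolding L by blast
      moreover have "\<forall>s\<in>set L. s \<in> e i \<longleftrightarrow> s \<in> e j" using that(3) by (simp add: bits_def)
      ultimately show False using t[OF that(1,2) \<open>i \<noteq> j\<close>] by blast
    qed
    have "\<exists>q. \<bar>real_of_rat q - p i\<bar> < \<epsilon>" for i
    proof -
      obtain q where "p i - \<epsilon> < of_rat q" "of_rat q < p i + \<epsilon>"
        using of_rat_dense[of "p i - \<epsilon>" "p i + \<epsilon>"] \<epsilon> by auto
      then show ?thesis by (intro exI[of _ q]) auto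
    qed
    then obtain q where q: "\<And>i. \<bar>real_of_rat (q i) - p i\<bar> < \<epsilon>" by metis
    obtain h where h: "set h = (\<lambda>i. (bits L i, q i)) ` F"
      using finite_list[OF finite_imageI[OF F(1), of "\<lambda>i. (bits L i, q i)"]] by (elim exE)
    have "\<bar>d (L, h) i - p i\<bar> < \<epsilon>" if i: "i \<in> F" for i
    proof -
      \<comment> \<open>The lookup may return the entry made for some \<open>j\<close>; equal bit
        vectors then force \<open>j = i\<close>.\<close>
      have "bits L i \<in> fst ` set h" unfolding h using i by force
      then obtain r where r: "map_of h (bits L i) = Some r"
        by (metis map_of_eq_None_iff not_None_eq)
      then have "(bits L i, r) \<in> set h" by (rule map_of_SomeD)
      then obtain j where "j \<in> F" "bits L i = bits L j" "r = q j" unfolding h by auto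
      then have "r = q i" using bits_inj i by blast
      then show ?thesis using q[of i] by (simp add: d_def r)
    qed
    then show ?thesis using LT by (intro bexI[of _ "(L, h)"]) auto
  qed
  then show ?thesis by blast
qed

lemma partial_mon_trivial:
  fixes K :: "'k set"
  assumes "comm_group G"
  shows "partial_mon G K {(\<one>\<^bsub>G\<^esub>, \<lambda>_. 0)}"
proof -
  have "group G" "group (real_functions :: ('k \<Rightarrow> real) monoid)"
    using assms comm_group_real_functions by (auto intro: comm_group.axioms(2))
  then have "subgroup {\<one>\<^bsub>G \<times>\<times> real_functions\<^esub>} (G \<times>\<times> (real_functions :: ('k \<Rightarrow> real) monoid))"
    by (intro group.triv_subgroup DirProd_group)
  then show ?thesis by (simp add: partial_mon_def)
qed

text \<open>Representatives are chosen arbitrarily, since any two for the same element differ by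
  integers on the index set and the projection to the circle identifies them.\<close>

lemma partial_mon_imp_mon:
  assumes G: "comm_group G" and P: "partial_mon G (Field \<kappa>) P" and dom: "carrier G \<subseteq> fst ` P"
  obtains \<phi> where "\<phi> \<in> mon G (torus_group \<kappa>)"
    "\<And>a u i. (a, u) \<in> P \<Longrightarrow> i \<in> Field \<kappa> \<Longrightarrow> \<phi> a i = circle_proj (u i)"
proof -
  have "\<forall>a\<in>carrier G. \<exists>u. (a, u) \<in> P" using dom by force
  from bchoice[OF this] obtain v where "\<forall>a\<in>carrier G. (a, v a) \<in> P" by (elim exE)
  then have v: "(a, v a) \<in> P" if "a \<in> carrier G" for a using that by (rule bspec)
  define \<phi> where "\<phi> a = (\<lambda>i\<in>Field \<kappa>. circle_proj (v a i))" for a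
  have \<phi>: "\<phi> a = (\<lambda>i\<in>Field \<kappa>. circle_proj (u i))" if "(a, u) \<in> P" for a u
  proof -
    have "(a, v a) \<in> P" using v partial_mon_carrier[OF G P that] .
    then show ?thesis
      using partial_mon_cong[OF G P _ that] unfolding \<phi>_def
      by (intro restrict_ext) (auto simp: circle_proj_eq_iff)
  qed
  have "\<phi> \<in> hom G (torus_group \<kappa>)"
  proof (rule homI)
    show "\<phi> a \<in> carrier (torus_group \<kappa>)" for a
      by (auto simp: \<phi>_def torus_group_def carrier_circle_group)
    fix a b assume "a \<in> carrier G" "b \<in> carrier G"
    then have "(a \<otimes>\<^bsub>G\<^esub> b, \<lambda>i. v a i + v b i) \<in> P"
      using partial_mon_mult[OF G P] v by blast
    from \<phi>[OF this] show "\<phi> (a \<otimes>\<^bsub>G\<^esub> b) = \<phi> a \<otimes>\<^bsub>torus_group \<kappa>\<^esub> \<phi> b"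
      by (simp add: \<phi>_def torus_group_def circle_group_mult cong: restrict_cong)
  qed
  moreover have "inj_on \<phi> (carrier G)"
  proof (rule inj_onI)
    fix a b assume ab: "a \<in> carrier G" "b \<in> carrier G" "\<phi> a = \<phi> b"
    have "\<forall>i\<in>Field \<kappa>. v a i - v b i \<in> \<int>"
    proof
      fix i assume "i \<in> Field \<kappa>"
      then show "v a i - v b i \<in> \<int>"
        using fun_cong[OF ab(3), of i] by (simp add: \<phi>_def circle_proj_eq_iff)
    qed
    then show "a = b" using partial_mon_cong[OF G P v v] ab(1,2) by blast
  qed
  ultimately show thesis using \<phi> by (intro that[of \<phi>]) (auto simp: mon_def)
qed

text \<open>Two runs of the recursion. The first has \<open>|T|\<close> tasks and makes the image of
  \<open>S\<close> dense; its domain stays smaller than the power set of the index set, which leaves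
  room for the second run through all of \<open>G\<close>.\<close>

lemma ex_dense_mon:
  fixes \<kappa> :: "'k rel" and T :: "'t set" and G :: "('g, 'm) monoid_scheme"
  assumes G: "comm_group G" "S \<subseteq> carrier G" and cardG: "|carrier G| \<le>o |Pow (Field \<kappa>)|"
    and T: "|UNIV :: nat set| <o |T|" "|T| \<le>o |Field \<kappa>|" "|Field \<kappa>| \<le>o |Pow T|"
    and mult: "\<And>n. 0 < n \<Longrightarrow> |T| \<le>o |multiples G n S|"
  shows "\<exists>\<phi> \<in> mon G (torus_group \<kappa>). torus_topology \<kappa> closure_of (\<phi> ` S) = topspace (torus_topology \<kappa>)"
proof -
  interpret comm_group G by fact
  let ?K = "Field \<kappa>"
  have nat_T: "|UNIV :: nat set| \<le>o |T|" using T(1) by (rule ordLess_imp_ordLeq)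
  then have infT: "infinite T" by (simp add: infinite_iff_card_of_nat)
  have infK: "infinite ?K"
    using ordLeq_transitive[OF nat_T T(2)] by (simp add: infinite_iff_card_of_nat)
  have T_Pow: "|T| <o |Pow ?K|" using T(2) card_of_Pow by (rule ordLeq_ordLess_trans)
  have nat_Pow: "|UNIV :: nat set| <o |Pow ?K|" using T(1) T_Pow by (rule ordLess_transitive)
  obtain d :: "'t list \<times> (bool list \<times> rat) list \<Rightarrow> 'k \<Rightarrow> real" where d:
    "\<forall>F p \<epsilon>. finite F \<longrightarrow> F \<subseteq> ?K \<longrightarrow> 0 < \<epsilon> \<longrightarrow> (\<exists>w\<in>lists T \<times> UNIV. \<forall>i\<in>F. \<bar>d w i - p i\<bar> < \<epsilon>)"
    using ex_dense_targets[OF T(3)] by (elim exE)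
  \<comment> \<open>A task pairs a target with a natural number \<open>N\<close>, which is both the
    order bound and the precision. Every target is thus approached arbitrarily closely by images of
    elements of \<open>S\<close>.\<close>
  let ?W = "(lists T \<times> (UNIV :: (bool list \<times> rat) list set)) \<times> (UNIV :: nat set)"
  let ?P0 = "{(\<one>\<^bsub>G\<^esub>, \<lambda>_. 0)} :: ('g \<times> ('k \<Rightarrow> real)) set"
  have W: "|?W| \<le>o |T|"
    by (intro card_of_Times_le card_of_lists_le card_of_countable_le infT ordIso_imp_ordLeq card_of_refl)
  have P0: "|fst ` ?P0| <o |T|"
    by (intro finite_ordLess_infinite card_of_Well_order) (auto simp: Field_card_of infT)
  \<comment> \<open>Every \<open>k\<close> up to \<open>N\<close> divides \<open>N!\<close>, so if
    the multiple of \<open>x\<close> by \<open>N!\<close> avoids the subgroup generated by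
    \<open>H\<close>, then all multiples up to \<open>N\<close> avoid \<open>H\<close>.\<close>
  have step: "\<exists>x\<in>carrier G. x \<in> S \<and> (\<forall>k\<in>{1..N}. x [^]\<^bsub>G\<^esub> k \<notin> H)" if H: "|H| <o |T|" for N :: nat and H
  proof -
    let ?H = "generate G (H \<inter> carrier G)"
    have "|H \<inter> carrier G| <o |T|"
      by (rule ordLeq_ordLess_trans[OF card_of_mono1 H]) blast
    then have "|?H| <o |T|"
      by (intro card_of_generate_less is_group T(1)) auto
    then have "|?H| <o |multiples G (fact N) S|"
      using mult by (rule ordLess_ordLeq_trans) simp
    then have "\<not> multiples G (fact N) S \<subseteq> ?H"
      using card_of_mono1 not_ordLess_ordLeq by blast
    then obtain x where x: "x \<in> S" "x [^]\<^bsub>G\<^esub> (fact N :: nat) \<notin> ?H" by (auto simp: multiples_def)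
    have "x [^]\<^bsub>G\<^esub> k \<notin> H" if k: "k \<in> {1..N}" for k
    proof
      assume "x [^]\<^bsub>G\<^esub> k \<in> H"
      moreover have xG: "x \<in> carrier G" using x(1) G(2) by blast
      ultimately have kH: "x [^]\<^bsub>G\<^esub> k \<in> ?H" by (auto intro: generate.incl)
      have "k dvd (fact N :: nat)" using k by (intro dvd_fact) auto
      then obtain j where "(fact N :: nat) = k * j" by (auto elim: dvdE)
      then have "x [^]\<^bsub>G\<^esub> (fact N :: nat) = (x [^]\<^bsub>G\<^esub> k) [^]\<^bsub>G\<^esub> int j"
        using xG by (simp only: nat_pow_pow int_pow_int)
      also have "\<dots> \<in> ?H"
        using kH by (intro subgroup_int_pow_closed generate_is_subgroup) auto
      finally show False using x(2) by blast
    qed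
    then show ?thesis using x(1) G(2) by blast
  qed
  have "\<exists>P. partial_mon G ?K P \<and> ?P0 \<subseteq> P \<and> |fst ` P| \<le>o |T| \<and>
      (\<forall>w\<in>?W. \<exists>x u. x \<in> S \<and> (x, u) \<in> P \<and> (\<forall>i\<in>?K. \<bar>u i - d (fst w) i\<bar> \<le> 2 / (real (snd w) + 1)))"
    by (rule partial_mon_transfinite_extend[OF G(1) partial_mon_trivial[OF G(1)] P0 T(1)
          ordLess_imp_ordLeq[OF T_Pow] infK W]) (rule step)
  then obtain P1 where P1: "partial_mon G ?K P1" "|fst ` P1| \<le>o |T|"
    "\<forall>w\<in>?W. \<exists>x u. x \<in> S \<and> (x, u) \<in> P1 \<and> (\<forall>i\<in>?K. \<bar>u i - d (fst w) i\<bar> \<le> 2 / (real (snd w) + 1))"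
    by (elim exE conjE)
  have small: "|fst ` P1| <o |Pow ?K|" using P1(2) T_Pow by (rule ordLeq_ordLess_trans)
  \<comment> \<open>With \<open>N = 0\<close> the condition on powers is empty, so every
    \<open>a\<close> is admissible, including one that is already in the domain.\<close>
  have "\<exists>P. partial_mon G ?K P \<and> P1 \<subseteq> P \<and> |fst ` P| \<le>o |Pow ?K| \<and>
      (\<forall>a\<in>carrier G. \<exists>x u. x = a \<and> (x, u) \<in> P \<and> (\<forall>i\<in>?K. \<bar>u i - 0\<bar> \<le> 2 / (real 0 + 1)))"
    by (rule partial_mon_transfinite_extend[OF G(1) P1(1) small nat_Pow
          ordIso_imp_ordLeq[OF card_of_refl] infK cardG]) auto
  then obtain P2 where P2: "partial_mon G ?K P2" "P1 \<subseteq> P2"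
    and "\<forall>a\<in>carrier G. \<exists>x u. x = a \<and> (x, u) \<in> P2 \<and> (\<forall>i\<in>?K. \<bar>u i - 0\<bar> \<le> 2 / (real 0 + 1))"
    by (elim exE conjE)
  then have "carrier G \<subseteq> fst ` P2" by force
  then obtain \<phi> where \<phi>: "\<phi> \<in> mon G (torus_group \<kappa>)"
    "\<And>a u i. (a, u) \<in> P2 \<Longrightarrow> i \<in> ?K \<Longrightarrow> \<phi> a i = circle_proj (u i)"
    using partial_mon_imp_mon[OF G(1) P2(1)] by blast
  have "\<phi> ` S \<subseteq> carrier (torus_group \<kappa>)"
    using \<phi>(1) G(2) by (auto simp: mon_def hom_def)
  moreover have "\<exists>x\<in>\<phi> ` S. \<forall>i\<in>F. \<exists>t. \<bar>t - p i\<bar> < \<epsilon> \<and> x i = circle_proj t"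
    if F: "finite F" "F \<subseteq> ?K" and \<epsilon>: "0 < \<epsilon>" for F p \<epsilon>
  proof -
    obtain w where w: "w \<in> lists T \<times> UNIV" "\<forall>i\<in>F. \<bar>d w i - p i\<bar> < \<epsilon> / 2"
      using d[rule_format, OF F, of "\<epsilon> / 2" p] \<epsilon> by auto
    obtain N :: nat where N: "4 / \<epsilon> < real N" using reals_Archimedean2 by blast
    have "4 < \<epsilon> * (real N + 1)" using N \<epsilon> by (simp add: field_simps)
    then have N': "2 / (real N + 1) < \<epsilon> / 2" by (simp add: field_simps)
    obtain x u where xu: "x \<in> S" "(x, u) \<in> P1" "\<forall>i\<in>?K. \<bar>u i - d w i\<bar> \<le> 2 / (real N + 1)"
      using bspec[OF P1(3), of "(w, N)"] w(1) by auto
    have "\<bar>u i - p i\<bar> < \<epsilon> \<and> \<phi> x i = circle_proj (u i)" if i: "i \<in> F" for i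
    proof
      have iK: "i \<in> ?K" using i F(2) by blast
      show "\<bar>u i - p i\<bar> < \<epsilon>" using bspec[OF w(2) i] bspec[OF xu(3) iK] N' by linarith
      show "\<phi> x i = circle_proj (u i)" using \<phi>(2) iK xu(2) P2(2) by blast
    qed
    then show ?thesis using xu(1) by blast
  qed
  ultimately have "torus_topology \<kappa> closure_of (\<phi> ` S) = topspace (torus_topology \<kappa>)"
    by (subst dense_torus_iff) blast+
  then show ?thesis using \<phi>(1) by blast
qed

theorem theorem2p6:
  fixes \<kappa> \<tau> :: "'k rel" and G :: "('g, 'm) monoid_scheme" and S :: "'g set"
  assumes "Card_order \<kappa>" and "|UNIV :: real set| <o \<kappa>" and "\<tau> = clog \<kappa>"
    and "comm_group G" and "S \<subseteq> carrier G"
  shows "((\<exists>\<phi> \<in> mon G (torus_group \<kappa>).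
            torus_topology \<kappa> closure_of (\<phi> ` S) = topspace (torus_topology \<kappa>))
        \<longleftrightarrow> |carrier G| \<le>o ctwo ^c \<kappa> \<and>
            \<tau> \<le>o min_card {|multiples G n S| | n. 0 < n})
      \<and> (( |carrier G| \<le>o ctwo ^c \<kappa> \<and>
            \<tau> \<le>o min_card {|multiples G n S| | n. 0 < n})
        \<longleftrightarrow> |carrier G| \<le>o ctwo ^c \<kappa> \<and> wide G \<tau> S)"
proof -
  have G: "group G" using assms(4) by (rule comm_group.axioms(2))
  have K: "\<kappa> =o |Field \<kappa>|" by (rule ordIso_symmetric[OF card_of_Field_ordIso[OF assms(1)]])
  have "|UNIV :: real set| \<le>o |Field \<kappa>|"
    by (rule ordLess_imp_ordLeq[OF ordLess_ordIso_trans[OF assms(2) K]])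
  then have infK: "infinite (Field \<kappa>)"
    using card_of_ordLeq_infinite infinite_UNIV_char_0 by blast
  then have natLeq: "natLeq \<le>o \<kappa>"
    using ordLeq_ordIso_trans[OF _ ordIso_symmetric[OF K]] infinite_iff_natLeq_ordLeq by blast
  note \<tau> = clog[OF assms(1) natLeq, folded assms(3)]
  have T: "\<tau> =o |Field \<tau>|" by (rule ordIso_symmetric[OF card_of_Field_ordIso[OF \<tau>(1)]])
  have nat: "|UNIV :: nat set| <o |Field \<tau>|"
    by (rule nat_less_of_real_less_cexp[OF \<tau>(1) assms(2) \<tau>(3)])
  have min: "\<tau> \<le>o min_card {|multiples G n S| | n. 0 < n} \<longleftrightarrow> (\<forall>n>0. \<tau> \<le>o |multiples G n S| )"
    by (subst le_min_card_iff) (auto simp: card_of_Card_order)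
  have "|carrier G| \<le>o ctwo ^c \<kappa> \<and> (\<forall>n>0. \<tau> \<le>o |multiples G n S| )"
    if "\<phi> \<in> mon G (torus_group \<kappa>)"
      and dense: "torus_topology \<kappa> closure_of (\<phi> ` S) = topspace (torus_topology \<kappa>)" for \<phi>
  proof (intro conjI allI impI)
    have \<phi>: "\<phi> \<in> hom G (torus_group \<kappa>)" "inj_on \<phi> (carrier G)"
      using that(1) by (auto simp: mon_def)
    have "|carrier G| \<le>o |carrier (torus_group \<kappa>)|"
      using \<phi> by (intro card_of_ordLeqI[of \<phi>]) (auto simp: hom_def)
    then show "|carrier G| \<le>o ctwo ^c \<kappa>"
      using card_of_torus_le[OF assms(1,2)] by (rule ordLeq_transitive)
    fix n :: nat assume "0 < n"
    then have le: "|Field \<kappa>| \<le>o |Pow (multiples G n S)|"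
      by (rule card_le_Pow_multiples[OF assms(4,5) \<phi>(1) dense])
    \<comment> \<open>The logarithm is a minimum over infinite cardinals, so \<open>nS\<close> must
      be known to be infinite before minimality can be applied to its cardinal.\<close>
    then have inf: "infinite (multiples G n S)"
      using infK card_of_ordLeq_infinite finite_Pow_iff by blast
    have "\<kappa> \<le>o ctwo ^c |multiples G n S|"
      using ordIso_ordLeq_trans[OF K ordLeq_ordIso_trans[OF le]] card_of_Pow_Field_cexp[of "|multiples G n S|"]
      by (simp add: Field_card_of)
    moreover have "natLeq \<le>o |multiples G n S|"
      using inf infinite_iff_natLeq_ordLeq by blast
    \<comment> \<open>Minimality is used through \<open>clog_least\<close>, because
      \<open>nS\<close> lives in a different type from \<kappa>.\<close>
    ultimately show "\<tau> \<le>o |multiples G n S|"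
      unfolding assms(3)
      by (intro clog_least assms(1) natLeq card_of_Card_order)
  qed
  moreover have "\<exists>\<phi> \<in> mon G (torus_group \<kappa>).
      torus_topology \<kappa> closure_of (\<phi> ` S) = topspace (torus_topology \<kappa>)"
    if "|carrier G| \<le>o ctwo ^c \<kappa>" and large: "\<forall>n>0. \<tau> \<le>o |multiples G n S|"
  proof (rule ex_dense_mon[OF assms(4,5) _ nat])
    show "|carrier G| \<le>o |Pow (Field \<kappa>)|"
      by (rule ordLeq_ordIso_trans[OF that(1) ordIso_symmetric[OF card_of_Pow_Field_cexp]])
    show "|Field \<tau>| \<le>o |Field \<kappa>|" using \<tau>(4) by (rule card_of_mono2)
    show "|Field \<kappa>| \<le>o |Pow (Field \<tau>)|"
      by (rule ordIso_ordLeq_trans[OF ordIso_symmetric[OF K]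
            ordLeq_ordIso_trans[OF \<tau>(3) ordIso_symmetric[OF card_of_Pow_Field_cexp]]])
    show "|Field \<tau>| \<le>o |multiples G n S|" if "0 < n" for n
      using large that ordIso_ordLeq_trans[OF ordIso_symmetric[OF T]] by blast
  qed
  ultimately show ?thesis
    unfolding min wide_iff[OF G assms(5) \<tau>(1) nat] by blast
qed

end
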